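(* Let $n\ge 2$, let $1<s\le\infty$, and let $\Omega\in L^s(S^{n-1})$ be homogeneous of degree zero on $\mathbb R^n$. Let $0<\alpha<n$, $1\le s'<p<n/\alpha$, $1/q=1/p-\alpha/n$, $0<\kappa<p/q$, and let $w$ be a weight on $\mathbb R^n$ with $w^{s'}\in A(p/s',q/s')$. Then the fractional maximal operator $$M_{\Omega,\alpha}f(x)=\sup_{r>0}\frac{1}{r^{n-\alpha}}\int_{|y|\le r}\big|\Omega(y')f(x-y)\big|\,dy$$ is bounded from $L^{p,\kappa}(w^p,w^q)$ to $L^{q,\kappa q/p}(w^q)$; that is, there is a constant $C>0$ such that $\|M_{\Omega,\alpha}f\|_{L^{q,\kappa q/p}(w^q)}\le C\|f\|_{L^{p,\kappa}(w^p,w^q)}$ for all $f\in L^{p,\kappa}(w^p,w^q)$.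
   Context: Notation: $S^{n-1}$ is the unit sphere of $\mathbb R^n$ with normalized Lebesgue measure $d\sigma$; $y'=y/|y|$ for $y\ne 0$; $\Omega$ homogeneous of degree zero means $\Omega(\lambda x)=\Omega(x)$ for all $\lambda>0$, $x\neq 0$, and $\Omega\in L^s(S^{n-1})$ refers to its restriction to $S^{n-1}$. Here $s'=s/(s-1)$ if $1<s<\infty$ and $s'=1$ if $s=\infty$. A weight is a nonnegative locally integrable function on $\mathbb R^n$. For a weight $v$ and a ball $B$, $v(B)=\int_B v(x)\,dx$, and $|B|$ is the Lebesgue measure of $B$. Class $A(p,q)$: for $1<p<q<\infty$, a weight $w$ belongs to $A(p,q)$ if there is $C>0$ such that for every ball $B\subseteq\mathbb R^n$, $$\left(\frac1{|B|}\int_B w(x)^q\,dx\right)^{1/q}\left(\frac1{|B|}\int_B w(x)^{-p'}\,dx\right)^{1/p'}\le C,$$ where $p'=p/(p-1)$. Weighted Morrey spaces: for $1\le p<\infty$, $0<\kappa<1$ and a weight $w$, $L^{p,\kappa}(w)$ is the set of $f\in L^p_{loc}(w)$ with $$\|f\|_{L^{p,\kappa}(w)}=\sup_B\left(\frac1{w(B)^\kappa}\int_B|f(x)|^p w(x)\,dx\right)^{1/p}<\infty.$$ For two weights $u,v$, $L^{p,\kappa}(u,v)$ is the set of $f\in L^p_{loc}(u)$ with $$\|f\|_{L^{p,\kappa}(u,v)}=\sup_B\left(\frac1{v(B)^\kappa}\int_B|f(x)|^p u(x)\,dx\right)^{1/p}<\infty.$$ Both suprema are over all balls $B\subseteq\mathbb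 R^n$. *)

theory Defs
  imports "HOL-Analysis.Analysis" "HOL-Probability.Essential_Supremum"
begin

text \<open>Powers of elements of \<open>[0,\<infinity>]\<close> with a real exponent.  In contrast to \<^const>\<open>powr\<close> on the
  reals, where \<open>0 powr a = 0\<close> for every \<open>a\<close>, a negative power of \<open>0\<close> is \<open>\<infinity>\<close> here.\<close>

definition epow :: "ennreal \<Rightarrow> real \<Rightarrow> ennreal"
  where "epow x a =
    (if a = 0 then 1
     else if x = 0 then (if a > 0 then 0 else \<infinity>)
     else if x = \<infinity> then (if a > 0 then \<infinity> else 0)
     else ennreal (enn2real x powr a))"

definition conj_exp :: "ereal \<Rightarrow> real"
  where "conj_exp s = (if s = \<infinity> then 1 else real_of_ereal s / (real_of_ereal s - 1))"

text \<open>The normalized Lebesgue measure \<open>d\<sigma>\<close> of the unit sphere: the measure of a set \<open>A\<close> of directions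
  is the proportion of the unit ball occupied by the cone over \<open>A\<close>.  Note that \<open>sgn x = x / |x|\<close>,
  and that \<open>sgn 0 = 0\<close> is off the sphere, but \<open>{0}\<close> is a null set.\<close>

definition sphere_measure :: "'a::euclidean_space measure"
  where "sphere_measure =
    completion (restrict_space (distr (uniform_measure lborel (ball 0 1)) borel sgn) (sphere 0 1))"

definition Ls_sphere :: "ereal \<Rightarrow> ('a::euclidean_space \<Rightarrow> complex) set"
  where "Ls_sphere s = {\<Omega>. \<Omega> \<in> borel_measurable sphere_measure \<and>
    (if s = \<infinity> then esssup sphere_measure (\<lambda>x. ennreal (norm (\<Omega> x))) < \<infinity>
     else (\<integral>\<^sup>+ x. ennreal (norm (\<Omega> x) powr real_of_ereal s) \<partial>sphere_measure) < \<infinity>)}"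

definition homogeneous_deg0 :: "('a::euclidean_space \<Rightarrow> complex) \<Rightarrow> bool"
  where "homogeneous_deg0 \<Omega> \<longleftrightarrow> (\<forall>t>0. \<forall>x. x \<noteq> 0 \<longrightarrow> \<Omega> (t *\<^sub>R x) = \<Omega> x)"

definition weight :: "('a::euclidean_space \<Rightarrow> real) \<Rightarrow> bool"
  where "weight w \<longleftrightarrow> (\<forall>x. 0 \<le> w x) \<and> (\<forall>K. compact K \<longrightarrow> set_integrable lebesgue K w)"

definition A_class :: "real \<Rightarrow> real \<Rightarrow> ('a::euclidean_space \<Rightarrow> real) set"
  where "A_class p q = {w. weight w \<and> (\<exists>C::real. C > 0 \<and> (\<forall>c r. r > 0 \<longrightarrow>
     epow ((\<integral>\<^sup>+ x\<in>ball c r. epow (ennreal (w x)) q \<partial>lebesgue) / emeasure lebesgue (ball c r)) (1 / q)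
     * epow ((\<integral>\<^sup>+ x\<in>ball c r. epow (ennreal (w x)) (- conj_exp (ereal p)) \<partial>lebesgue)
             / emeasure lebesgue (ball c r)) (1 / conj_exp (ereal p))
     \<le> ennreal C))}"

text \<open>The weighted spaces are set up for functions \<open>g\<close> with values in \<open>[0,\<infinity>]\<close>, so that they apply both
  to the modulus \<open>|f|\<close> of a complex function and to maximal functions, which may be infinite at some
  points.  The one-weight space \<open>L\<^sup>p\<^sup>,\<^sup>\<kappa>(w)\<close> is the case \<open>u = v = w\<close>.\<close>

definition Lp_loc :: "real \<Rightarrow> ('a::euclidean_space \<Rightarrow> real) \<Rightarrow> ('a \<Rightarrow> ennreal) set"
  where "Lp_loc p u = {g. g \<in> borel_measurable lebesgue \<and>
    (\<forall>K. compact K \<longrightarrow> (\<integral>\<^sup>+ x\<in>K. epow (g x) p * ennreal (u x) \<partial>lebesgue) < \<infinity>)}"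

definition morrey_norm ::
    "real \<Rightarrow> real \<Rightarrow> ('a::euclidean_space \<Rightarrow> real) \<Rightarrow> ('a \<Rightarrow> real) \<Rightarrow> ('a \<Rightarrow> ennreal) \<Rightarrow> ennreal"
  where "morrey_norm p \<kappa> u v g =
    (SUP (c, r) \<in> UNIV \<times> {0<..}.
       epow ((\<integral>\<^sup>+ x\<in>ball c r. epow (g x) p * ennreal (u x) \<partial>lebesgue)
             / epow (\<integral>\<^sup>+ x\<in>ball c r. ennreal (v x) \<partial>lebesgue) \<kappa>) (1 / p))"

definition morrey ::
    "real \<Rightarrow> real \<Rightarrow> ('a::euclidean_space \<Rightarrow> real) \<Rightarrow> ('a \<Rightarrow> real) \<Rightarrow> ('a \<Rightarrow> ennreal) set"
  where "morrey p \<kappa> u v = {g \<in> Lp_loc p u. morrey_norm p \<kappa> u v g < \<infinity>}"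

definition modulus :: "('a \<Rightarrow> complex) \<Rightarrow> 'a \<Rightarrow> ennreal"
  where "modulus f x = ennreal (norm (f x))"

definition frac_max ::
    "('a::euclidean_space \<Rightarrow> complex) \<Rightarrow> real \<Rightarrow> ('a \<Rightarrow> complex) \<Rightarrow> 'a \<Rightarrow> ennreal"
  where "frac_max \<Omega> \<alpha> f x =
    (SUP r \<in> {0<..}. ennreal (1 / r powr (real DIM('a) - \<alpha>))
       * (\<integral>\<^sup>+ y\<in>cball 0 r. ennreal (norm (\<Omega> (sgn y) * f (x - y))) \<partial>lebesgue))"

end

theory Submission
  imports Defs
begin

text \<open>Put \<open>t = s'\<close>, \<open>P = p/t\<close>, \<open>Q = q/t\<close>, \<open>W = w\<^sup>t\<close>, \<open>F = |f|\<^sup>t\<close>.  Hoelder's inequality on balls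
  absorbs the kernel: \<open>M\<^sub>\<Omega>\<^sub>,\<^sub>\<alpha> f\<close> is at most a constant times \<open>(M F)\<^bsup>1/t\<^esup>\<close>, where \<open>M\<close> is the fractional
  maximal operator \<open>M F(x) = sup |B|\<^bsup>-d\<^esup> \<integral>\<^sub>B F\<close> over the balls \<open>B\<close> containing \<open>x\<close> and
  \<open>d = 1 - \<alpha>t/n = 1/Q + 1/P'\<close>.  It remains to bound \<open>M\<close> for a weight \<open>W\<close> in \<open>A(P,Q)\<close>.

  Let \<open>V = W\<^sup>Q dx\<close> and \<open>S = W\<^bsup>-P'\<^esup> dx\<close>.  Hoelder's inequality reverses the \<open>A(P,Q)\<close> condition, so
  both measures are doubling and their maximal operators \<open>M\<^sub>V\<close>, \<open>M\<^sub>S\<close> are bounded on \<open>L\<^sup>r\<close> for \<open>r > 1\<close>.  With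
  \<open>g = F W\<^bsup>P'\<^esup>\<close>, \<open>\<rho> = 1 + P'/Q\<close> and \<open>J = \<integral> F\<^sup>P W\<^sup>P\<close> one has pointwise
  \<open>M F \<le> C J\<^bsup>(1 - P/Q)/P\<^esup> (M\<^sub>V ((M\<^sub>S g)\<^bsup>P/\<rho>\<^esup> W\<^bsup>-Q\<^esup>))\<^bsup>\<rho>/Q\<^esup>\<close> (an argument of Lerner and of Lacey, Moen, Perez and
  Torres), hence \<open>L\<^sup>P(W\<^sup>P)\<close> to \<open>L\<^sup>Q(W\<^sup>Q)\<close> boundedness without reverse Hoelder inequalities.  For the
  Morrey norm on a ball \<open>B\<close>, split \<open>F\<close> at \<open>3B\<close>: the near part is the strong type bound, and on the far
  part every average is controlled by a power \<open>\<kappa>/P - 1/Q < 0\<close> of \<open>V(B)\<close>.\<close>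

section \<open>Powers in \<open>[0,\<infinity>]\<close> and Hoelder's inequality\<close>

lemma sets_borel_ball [measurable]: "ball c r \<in> sets borel" "cball c r \<in> sets borel"
  by simp_all

lemma epow_zero_left [simp]: "0 < a \<Longrightarrow> epow 0 a = 0"
  by (simp add: epow_def)

lemma epow_top_left [simp]: "0 < a \<Longrightarrow> epow top a = top"
  by (simp add: epow_def)

lemma epow_zero_right [simp]: "epow x 0 = 1"
  by (simp add: epow_def)

lemma epow_ennreal: "0 < x \<Longrightarrow> epow (ennreal x) a = ennreal (x powr a)"
  by (simp add: epow_def)

lemma epow_ennreal_nonneg: "0 \<le> x \<Longrightarrow> 0 < a \<Longrightarrow> epow (ennreal x) a = ennreal (x powr a)"
  by (cases "x = 0") (auto simp: epow_ennreal)

lemma ennreal_zero_pos_top_cases: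
  obtains "x = 0" | r where "0 < r" "x = ennreal r" | "x = top"
  by (cases x) (auto simp: le_less)

lemma epow_one_right [simp]: "epow x 1 = x"
  by (cases x rule: ennreal_zero_pos_top_cases) (auto simp: epow_ennreal)

text \<open>A negative exponent swaps 0 and infinity, so the conventions of \<open>epow\<close> at
  both ends are compatible with multiplying exponents of either sign.\<close>

lemma epow_epow: "epow (epow x a) b = epow x (a * b)"
proof (cases x rule: ennreal_zero_pos_top_cases)
  case (2 r)
  then show ?thesis by (simp add: epow_ennreal powr_powr)
qed (auto simp: epow_def mult_less_0_iff zero_less_mult_iff)

text \<open>The sign of \<open>a\<close> matters because of \<open>0 * top = 0\<close>: for
  \<open>x = 0\<close>, \<open>y = top\<close> and \<open>a < 0\<close> the left side is infinite
  while the right side is 0.\<close>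

lemma epow_mult: "0 \<le> a \<Longrightarrow> epow (x * y) a = epow x a * epow y a"
  by (cases "a = 0"; cases x rule: ennreal_zero_pos_top_cases; cases y rule: ennreal_zero_pos_top_cases)
    (auto simp: epow_ennreal powr_mult ennreal_mult_top ennreal_top_mult simp flip: ennreal_mult)

lemma epow_add: "0 \<le> a \<Longrightarrow> 0 \<le> b \<Longrightarrow> epow x (a + b) = epow x a * epow x b"
  by (cases "a = 0"; cases "b = 0"; cases x rule: ennreal_zero_pos_top_cases)
    (auto simp: epow_ennreal powr_add ennreal_mult_top simp flip: ennreal_mult)

lemma epow_mono: "x \<le> y \<Longrightarrow> 0 \<le> a \<Longrightarrow> epow x a \<le> epow y a"
  by (cases "a = 0"; cases x rule: ennreal_zero_pos_top_cases; cases y rule: ennreal_zero_pos_top_cases)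
    (auto simp: epow_ennreal powr_mono2 top_unique)

lemma epow_eq_0_iff: "0 < a \<Longrightarrow> epow x a = 0 \<longleftrightarrow> x = 0"
  by (cases x rule: ennreal_zero_pos_top_cases) (auto simp: epow_ennreal)

lemma epow_eq_top_iff: "0 < a \<Longrightarrow> epow x a = top \<longleftrightarrow> x = top"
  by (cases x rule: ennreal_zero_pos_top_cases) (auto simp: epow_ennreal)

text \<open>A quasi-triangle inequality from \<open>x + y \<le> 2 * max x y\<close>, which treats
  exponents below and above 1 with one constant.\<close>

lemma epow_add_le:
  assumes "0 < a"
  shows "epow (x + y) a \<le> ennreal (2 powr a) * (epow x a + epow y a)"
proof -
  have "x + y \<le> 2 * max x y"
    by (metis add_mono max.cobounded1 max.cobounded2 mult_2)
  then have "epow (x + y) a \<le> epow (ennreal 2 * max x y) a"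
    using assms by (intro epow_mono) (auto simp: ennreal_numeral)
  also have "\<dots> = ennreal (2 powr a) * epow (max x y) a"
    using assms epow_ennreal[of 2 a] by (subst epow_mult) auto
  also have "\<dots> \<le> ennreal (2 powr a) * (epow x a + epow y a)"
    by (intro mult_left_mono) (auto simp: max_def add_increasing add_increasing2)
  finally show ?thesis .
qed

lemma borel_measurable_epow [measurable]:
  assumes [measurable]: "f \<in> borel_measurable M"
  shows "(\<lambda>x. epow (f x) a) \<in> borel_measurable M"
  unfolding epow_def by measurable

text \<open>Undoes the quotient and the \<open>p\<close>-th root in a Morrey norm, so that a norm
  bound becomes an integral bound on a single ball. The division can be reversed because
  \<open>Y\<close> is nonzero and finite.\<close>

lemma epow_le_divD:
  assumes "epow (X / Y) (1 / p) \<le> N" "0 < p" "Y \<noteq> 0" "Y \<noteq> top"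
  shows "X \<le> epow N p * Y"
proof -
  have "X / Y = epow (epow (X / Y) (1 / p)) p"
    using assms by (simp add: epow_epow)
  also have "\<dots> \<le> epow N p" using assms by (intro epow_mono) auto
  finally have "X / Y * Y \<le> epow N p * Y" by (rule mult_right_mono) simp
  moreover have "X / Y * Y = X"
    using assms by (metis ennreal_times_divide mult.commute mult_divide_eq_ennreal)
  ultimately show ?thesis by simp
qed

section \<open>Young's and Hoelder's inequalities with values in [0, infinity]\<close>

lemma ennreal_Young:
  assumes "0 < x" "0 < y" "x + y = (1::real)"
  shows "epow a x * epow b y \<le> ennreal x * a + ennreal y * b"
proof (cases "a = top \<or> b = top")
  case True
  then show ?thesis using assms by (auto simp: ennreal_mult_top)
next
  case False
  then obtain a' b' where ab: "a = ennreal a'" "b = ennreal b'" "0 \<le> a'" "0 \<le> b'"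
    by (metis ennreal_cases)
  have "a' powr x * b' powr y \<le> x * a' + y * b'"
    using Youngs_inequality_0[of x y a' b'] assms ab
    by (cases "a' = 0 \<or> b' = 0") auto
  then show ?thesis using assms ab
    by (auto simp: epow_ennreal_nonneg simp flip: ennreal_mult ennreal_plus)
qed

text \<open>The form \<open>f^x g^y\<close> with \<open>x + y = 1\<close> suits weights, which enter
  as powers. If one integral is 0, the left integrand vanishes almost everywhere; if both are
  nonzero and one is infinite, so is the right side; otherwise both are normalised to 1 and Young's
  inequality is integrated.\<close>

lemma nn_integral_Holder:
  assumes [measurable]: "f \<in> borel_measurable M" "g \<in> borel_measurable M"
    and xy: "0 < x" "0 < y" "x + y = (1::real)"
  shows "(\<integral>\<^sup>+ t. epow (f t) x * epow (g t) y \<partial>M)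
    \<le> epow (\<integral>\<^sup>+ t. f t \<partial>M) x * epow (\<integral>\<^sup>+ t. g t \<partial>M) y"
proof -
  define A where "A = (\<integral>\<^sup>+ t. f t \<partial>M)"
  define B where "B = (\<integral>\<^sup>+ t. g t \<partial>M)"
  consider "A = 0" | "B = 0" | "A \<noteq> 0" "B \<noteq> 0" "A = top \<or> B = top"
    | "A \<noteq> 0" "B \<noteq> 0" "A \<noteq> top" "B \<noteq> top" by blast
  then have "(\<integral>\<^sup>+ t. epow (f t) x * epow (g t) y \<partial>M) \<le> epow A x * epow B y"
  proof cases
    case 1
    then have "AE t in M. f t = 0" by (simp add: A_def nn_integral_0_iff_AE)
    then have "AE t in M. epow (f t) x * epow (g t) y = 0" using xy by auto
    then have "(\<integral>\<^sup>+ t. epow (f t) x * epow (g t) y \<partial>M) = 0"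
      by (subst nn_integral_0_iff_AE) auto
    then show ?thesis by simp
  next
    case 2
    then have "AE t in M. g t = 0" by (simp add: B_def nn_integral_0_iff_AE)
    then have "AE t in M. epow (f t) x * epow (g t) y = 0" using xy by auto
    then have "(\<integral>\<^sup>+ t. epow (f t) x * epow (g t) y \<partial>M) = 0"
      by (subst nn_integral_0_iff_AE) auto
    then show ?thesis by simp
  next
    case 3
    then have "epow A x * epow B y = top"
      using xy by (auto simp: ennreal_mult_eq_top_iff epow_eq_0_iff epow_eq_top_iff)
    then show ?thesis by simp
  next
    case 4
    have *: "epow (f t) x * epow (g t) y =
        epow A x * epow B y * (epow (f t / A) x * epow (g t / B) y)" for t
    proof -
      have "f t = A * (f t / A)" "g t = B * (g t / B)"
        using 4 by (simp_all add: ennreal_times_divide mult.commute[of A] mult.commute[of B] mult_divide_eq_ennreal)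
      then have "epow (f t) x = epow A x * epow (f t / A) x"
        "epow (g t) y = epow B y * epow (g t / B) y"
        using xy by (metis epow_mult less_imp_le)+
      then show ?thesis by (simp add: ac_simps)
    qed
    have "(\<integral>\<^sup>+ t. epow (f t) x * epow (g t) y \<partial>M) =
      epow A x * epow B y * (\<integral>\<^sup>+ t. epow (f t / A) x * epow (g t / B) y \<partial>M)"
      by (subst *) (simp add: nn_integral_cmult)
    also have "\<dots> \<le> epow A x * epow B y * (\<integral>\<^sup>+ t. ennreal x * (f t / A) + ennreal y * (g t / B) \<partial>M)"
      by (intro mult_left_mono nn_integral_mono ennreal_Young xy) auto
    also have "(\<integral>\<^sup>+ t. ennreal x * (f t / A) + ennreal y * (g t / B) \<partial>M)
      = ennreal x * (A / A) + ennreal y * (B / B)"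
      by (simp add: nn_integral_add nn_integral_cmult nn_integral_divide A_def B_def)
    also have "\<dots> = 1"
      using 4 xy by (simp add: less_top flip: ennreal_plus)
    finally show ?thesis by simp
  qed
  then show ?thesis by (simp add: A_def B_def)
qed

lemma nn_integral_Holder_set:
  assumes [measurable]: "f \<in> borel_measurable M" "g \<in> borel_measurable M" "S \<in> sets M"
    and xy: "0 < x" "0 < y" "x + y = (1::real)"
  shows "(\<integral>\<^sup>+ t\<in>S. (epow (f t) x * epow (g t) y) \<partial>M)
    \<le> epow (\<integral>\<^sup>+ t\<in>S. f t \<partial>M) x * epow (\<integral>\<^sup>+ t\<in>S. g t \<partial>M) y"
proof -
  have "(\<integral>\<^sup>+ t\<in>S. (epow (f t) x * epow (g t) y) \<partial>M) =
    (\<integral>\<^sup>+ t. epow (f t * indicator S t) x * epow (g t * indicator S t) y \<partial>M)"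
    using xy by (intro nn_integral_cong) (auto split: split_indicator)
  also have "\<dots> \<le> epow (\<integral>\<^sup>+ t\<in>S. f t \<partial>M) x * epow (\<integral>\<^sup>+ t\<in>S. g t \<partial>M) y"
    by (intro nn_integral_Holder xy) auto
  finally show ?thesis .
qed

section \<open>The maximal function of a doubling measure\<close>

text \<open>The uncentred maximal function; membership of \<open>x\<close> in the ball forces
  \<open>r > 0\<close>. Admitting all balls that contain \<open>x\<close> makes the superlevel sets
  unions of balls, hence open, and lets the average over one ball bound the function from below on
  that whole ball.\<close>

definition maximal_fun :: "'a::euclidean_space measure \<Rightarrow> ('a \<Rightarrow> ennreal) \<Rightarrow> 'a \<Rightarrow> ennreal"
  where "maximal_fun \<mu> g x = (SUP (c, r) \<in> {(c, r). x \<in> ball c r}.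
    (\<integral>\<^sup>+ y\<in>ball c r. g y \<partial>\<mu>) / emeasure \<mu> (ball c r))"

lemma maximal_fun_upper:
  "x \<in> ball c r \<Longrightarrow> (\<integral>\<^sup>+ y\<in>ball c r. g y \<partial>\<mu>) / emeasure \<mu> (ball c r) \<le> maximal_fun \<mu> g x"
  unfolding maximal_fun_def by (rule SUP_upper2[where i="(c, r)"]) auto

lemma maximal_fun_less_iff:
  "a < maximal_fun \<mu> g x \<longleftrightarrow>
    (\<exists>c r. x \<in> ball c r \<and> a < (\<integral>\<^sup>+ y\<in>ball c r. g y \<partial>\<mu>) / emeasure \<mu> (ball c r))"
  unfolding maximal_fun_def by (auto simp: less_SUP_iff)

lemma open_maximal_fun_greater: "open {x. a < maximal_fun \<mu> g x}"
proof -
  have "{x. a < maximal_fun \<mu> g x} =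
      (\<Union>(c, r)\<in>{(c, r). a < (\<integral>\<^sup>+ y\<in>ball c r. g y \<partial>\<mu>) / emeasure \<mu> (ball c r)}. ball c r)"
    by (force simp: maximal_fun_less_iff)
  then show ?thesis by auto
qed

lemma borel_measurable_maximal_fun [measurable]: "maximal_fun \<mu> g \<in> borel_measurable borel"
  by (rule borel_measurableI_greater) (simp add: open_maximal_fun_greater)

text \<open>Integrated in \<open>x\<close> with \<open>y = maximal_fun \<mu> g x\<close>, this is
  the layer-cake formula. The case \<open>y = top\<close> is included because a maximal function may
  be infinite.\<close>

lemma nn_integral_powr_below:
  assumes "0 < e"
  shows "(\<integral>\<^sup>+ l. ennreal (l powr (e - 1)) * indicator {l. 0 < l \<and> ennreal l < y} l \<partial>lborel)
    = ennreal (1 / e) * epow y e" (is "?I y = _")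
proof -
  have fin: "?I (ennreal c) = ennreal (c powr e / e)" if "0 \<le> c" for c
  proof -
    have "((\<lambda>x. x powr (e - 1)) has_integral (c powr e / e)) {0..c}"
      using has_integral_powr_from_0[of "e - 1" c] assms that by simp
    then have "ennreal (c powr e / e) = (\<integral>\<^sup>+ l. ennreal (l powr (e - 1) * indicator {0..c} l) \<partial>lborel)"
      using assms by (subst nn_integral_has_integral_lebesgue[symmetric])
        (auto simp: mult.commute indicator_def if_distrib cong: if_cong)
    also have "\<dots> = ?I (ennreal c)"
    proof (rule nn_integral_cong_AE)
      \<comment> \<open>The two integrands disagree at most at the endpoints 0 and
        \<open>c\<close>.\<close>
      have "AE l in lborel. l \<noteq> 0 \<and> l \<noteq> c"
        using AE_lborel_singleton[of 0] AE_lborel_singleton[of c] by auto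
      then show "AE l in lborel. ennreal (l powr (e - 1) * indicator {0..c} l) =
        ennreal (l powr (e - 1)) * indicator {l. 0 < l \<and> ennreal l < ennreal c} l"
        by eventually_elim (auto simp: indicator_def ennreal_less_iff)
    qed
    finally show ?thesis ..
  qed
  show ?thesis
  proof (cases y)
    case (real c)
    then show ?thesis
      using assms by (simp add: fin epow_ennreal_nonneg flip: ennreal_mult)
  next
    case top
    have "?I top = top"
    proof (rule ccontr)
      assume "?I top \<noteq> top"
      then obtain m where m: "0 \<le> m" "?I top = ennreal m" by (cases "?I top") auto
      \<comment> \<open>The height at which the truncated integral already equals
        \<open>m + 1\<close>, against the assumed value \<open>m\<close> of the full
        integral.\<close>
      define c where "c = (e * (m + 1)) powr (1 / e)"
      have "ennreal (m + 1) = ?I (ennreal c)"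
        using assms m by (subst fin) (auto simp: c_def powr_powr)
      also have "\<dots> \<le> ?I top"
        by (intro nn_integral_mono mult_left_mono) (auto simp: indicator_def)
      finally show False using m by simp
    qed
    then show ?thesis using top assms by (simp add: ennreal_mult_top)
  qed
qed

text \<open>The indicator of the union is at most the number of sets containing the point, and
  Tonelli's theorem does the rest. An arbitrary countable index set fits the families of balls that
  a covering lemma returns.\<close>

lemma emeasure_UN_countable_le:
  assumes [measurable]: "\<And>i. i \<in> I \<Longrightarrow> X i \<in> sets M" and I [simp]: "countable I"
  shows "emeasure M (\<Union>(X ` I)) \<le> (\<integral>\<^sup>+i. emeasure M (X i) \<partial>count_space I)"
proof -
  have [measurable]: "\<Union>(X ` I) \<in> sets M" by (rule sets.countable_UN') auto
  have "emeasure M (\<Union>(X ` I)) = (\<integral>\<^sup>+x. indicator (\<Union>(X ` I)) x \<partial>M)" by simp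
  also have "\<dots> \<le> (\<integral>\<^sup>+x. \<integral>\<^sup>+i. indicator (X i) x \<partial>count_space I \<partial>M)"
  proof (intro nn_integral_mono)
    fix x
    show "indicator (\<Union>(X ` I)) x \<le> (\<integral>\<^sup>+i. indicator (X i) x \<partial>count_space I :: ennreal)"
    proof (cases "x \<in> \<Union>(X ` I)")
      case True
      then obtain i where i: "i \<in> I" "x \<in> X i" by auto
      then have "(1::ennreal) \<le> (\<integral>\<^sup>+i. indicator (X i) x \<partial>count_space I)"
        using nn_integral_ge_point[of i I "\<lambda>i. indicator (X i) x"] by simp
      then show ?thesis using True by simp
    qed simp
  qed
  also have "\<dots> = (\<integral>\<^sup>+i. \<integral>\<^sup>+x. indicator (X i) x \<partial>M \<partial>count_space I)"
    by (subst nn_integral_count_space_nn_integral) auto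
  also have "\<dots> = (\<integral>\<^sup>+i. emeasure M (X i) \<partial>count_space I)"
    by (intro nn_integral_cong) simp
  finally show ?thesis .
qed

section \<open>Weak and strong type bounds over a doubling measure\<close>

locale doubling_measure =
  fixes \<mu> :: "'a::euclidean_space measure" and K :: real
  assumes sets_eq: "sets \<mu> = sets lebesgue"
    and finite_ball: "0 < r \<Longrightarrow> emeasure \<mu> (ball c r) < \<infinity>"
    and pos_ball: "0 < r \<Longrightarrow> 0 < emeasure \<mu> (ball c r)"
    and K_pos: "0 < K"
    and doubling: "0 < r \<Longrightarrow> emeasure \<mu> (cball c (5 * r)) \<le> ennreal K * emeasure \<mu> (ball c r)"
begin

lemma space_eq [simp]: "space \<mu> = UNIV"
  using sets_eq_imp_space_eq[OF sets_eq] by simp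

lemma borel_imp_sets [measurable (raw)]: "S \<in> sets borel \<Longrightarrow> S \<in> sets \<mu>"
  by (simp add: sets_eq)

lemma borel_measurable_imp: "f \<in> borel_measurable borel \<Longrightarrow> f \<in> borel_measurable \<mu>"
  by (simp add: measurable_def sets_eq)

lemma ball_sets [measurable]: "ball c r \<in> sets \<mu>" "cball c r \<in> sets \<mu>"
  by (auto intro!: borel_imp_sets)

sublocale sigma_finite_measure \<mu>
proof
  show "\<exists>A. countable A \<and> A \<subseteq> sets \<mu> \<and> \<Union>A = space \<mu> \<and> (\<forall>a\<in>A. emeasure \<mu> a \<noteq> \<infinity>)"
  proof (intro exI[of _ "range (\<lambda>n::nat. ball 0 (real (Suc n)))"] conjI)
    show "\<Union>(range (\<lambda>n::nat. ball (0::'a) (real (Suc n)))) = space \<mu>"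
    proof safe
      fix x :: 'a
      obtain n where "norm x < real n" using reals_Archimedean2 by blast
      then show "x \<in> \<Union>(range (\<lambda>n::nat. ball (0::'a) (real (Suc n))))" by (auto intro!: exI[of _ n])
    qed auto
  qed (use finite_ball in \<open>auto simp: less_top\<close>)
qed

text \<open>Vitali's covering lemma selects disjoint balls whose fivefold dilates still cover the
  superlevel set; the doubling condition is stated with the factor 5 for this purpose.\<close>

lemma weak_type:
  assumes [measurable]: "g \<in> borel_measurable \<mu>"
  shows "a * emeasure \<mu> {x. a < maximal_fun \<mu> g x} \<le> ennreal K * (\<integral>\<^sup>+ x. g x \<partial>\<mu>)"
proof -
  \<comment> \<open>Vitali's lemma needs bounded radii, so they are cut off at \<open>n\<close>;
    continuity from below removes the cut-off at the end.\<close>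
  define T where "T n = {(c, r). 0 < r \<and> r \<le> real n \<and>
    a < (\<integral>\<^sup>+ y\<in>ball c r. g y \<partial>\<mu>) / emeasure \<mu> (ball c r)}" for n :: nat
  define E where "E n = (\<Union>i\<in>T n. ball (fst i) (snd i))" for n
  have E_meas [measurable]: "E n \<in> sets \<mu>" for n
    by (rule borel_imp_sets, rule borel_open) (auto simp: E_def)
  have E_eq: "{x. a < maximal_fun \<mu> g x} = (\<Union>n. E n)"
  proof safe
    fix x assume "a < maximal_fun \<mu> g x"
    then obtain c r where cr: "x \<in> ball c r" "a < (\<integral>\<^sup>+ y\<in>ball c r. g y \<partial>\<mu>) / emeasure \<mu> (ball c r)"
      by (auto simp: maximal_fun_less_iff)
    moreover have "0 < r" using cr(1) zero_le_dist[of c x] by (simp del: zero_le_dist)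
    ultimately have "(c, r) \<in> T (nat \<lceil>r\<rceil>)" by (auto simp: T_def)
    then show "x \<in> (\<Union>n. E n)" using cr by (force simp: E_def)
  next
    fix x n assume "x \<in> E n"
    then show "a < maximal_fun \<mu> g x" by (auto simp: E_def T_def maximal_fun_less_iff)
  qed
  have E_le: "a * emeasure \<mu> (E n) \<le> ennreal K * (\<integral>\<^sup>+ x. g x \<partial>\<mu>)" for n
  proof -
    have cov: "E n \<subseteq> (\<Union>i\<in>T n. ball (fst i) (snd i))" by (simp add: E_def)
    have bd: "0 < snd i \<and> snd i \<le> real n" if "i \<in> T n" for i using that by (auto simp: T_def)
    obtain C where C: "countable C" "C \<subseteq> T n"
      "pairwise (\<lambda>i j. disjnt (ball (fst i) (snd i)) (ball (fst j) (snd j))) C"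
      "E n \<subseteq> (\<Union>i\<in>C. ball (fst i) (5 * snd i))"
      by (rule Vitali_covering_lemma_balls[OF cov bd])
    have CT: "0 < snd i" "a < (\<integral>\<^sup>+ y\<in>ball (fst i) (snd i). g y \<partial>\<mu>) / emeasure \<mu> (ball (fst i) (snd i))"
      if "i \<in> C" for i using C(2) that by (auto simp: T_def)
    have "emeasure \<mu> (E n) \<le> emeasure \<mu> (\<Union>i\<in>C. ball (fst i) (5 * snd i))"
      using C by (intro emeasure_mono) (auto intro!: sets.countable_UN')
    also have "\<dots> \<le> (\<integral>\<^sup>+ i. emeasure \<mu> (ball (fst i) (5 * snd i)) \<partial>count_space C)"
      using C by (intro emeasure_UN_countable_le) auto
    finally have "a * emeasure \<mu> (E n) \<le> a * (\<integral>\<^sup>+ i. emeasure \<mu> (ball (fst i) (5 * snd i)) \<partial>count_space C)"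
      by (rule mult_left_mono) simp
    also have "\<dots> = (\<integral>\<^sup>+ i. a * emeasure \<mu> (ball (fst i) (5 * snd i)) \<partial>count_space C)"
      by (simp add: nn_integral_cmult)
    \<comment> \<open>On each selected ball the average of \<open>g\<close> exceeds
      \<open>a\<close>. Reading integrals of \<open>g\<close> as values of the measure
      \<open>density \<mu> g\<close> lets the disjointness of the balls turn the sum into one
      integral.\<close>
    also have "\<dots> \<le> (\<integral>\<^sup>+ i. ennreal K * emeasure (density \<mu> g) (ball (fst i) (snd i)) \<partial>count_space C)"
    proof (intro nn_integral_mono)
      fix i assume "i \<in> space (count_space C)"
      then have i: "i \<in> C" by simp
      let ?B = "ball (fst i) (snd i)"
      have "emeasure \<mu> (ball (fst i) (5 * snd i)) \<le> emeasure \<mu> (cball (fst i) (5 * snd i))"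
        by (intro emeasure_mono) auto
      also have "\<dots> \<le> ennreal K * emeasure \<mu> ?B"
        using CT(1)[OF i] by (rule doubling)
      finally have "a * emeasure \<mu> (ball (fst i) (5 * snd i)) \<le> a * (ennreal K * emeasure \<mu> ?B)"
        by (rule mult_left_mono) simp
      also have "\<dots> = ennreal K * (a * emeasure \<mu> ?B)" by (simp add: ac_simps)
      also have "a * emeasure \<mu> ?B \<le> (\<integral>\<^sup>+ y\<in>?B. g y \<partial>\<mu>) / emeasure \<mu> ?B * emeasure \<mu> ?B"
        using CT(2)[OF i] by (intro mult_right_mono) auto
      also have "\<dots> = (\<integral>\<^sup>+ y\<in>?B. g y \<partial>\<mu>)"
        using pos_ball[OF CT(1)[OF i]] finite_ball[OF CT(1)[OF i]]
        by (metis ennreal_times_divide mult.commute mult_divide_eq_ennreal infinity_ennreal_def less_irrefl)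
      also have "\<dots> = emeasure (density \<mu> g) ?B" by (simp add: emeasure_density)
      finally show "a * emeasure \<mu> (ball (fst i) (5 * snd i)) \<le> ennreal K * emeasure (density \<mu> g) ?B"
        by (simp add: mult_left_mono)
    qed
    also have "\<dots> = ennreal K * emeasure (density \<mu> g) (\<Union>i\<in>C. ball (fst i) (snd i))"
      using C by (subst emeasure_UN_countable)
        (auto simp: nn_integral_cmult disjoint_family_on_def pairwise_def disjnt_def)
    also have "\<dots> \<le> ennreal K * emeasure (density \<mu> g) UNIV"
      using emeasure_space[of "density \<mu> g"] by (intro mult_left_mono) auto
    also have "\<dots> = ennreal K * (\<integral>\<^sup>+ x. g x \<partial>\<mu>)"
      using sets.top[of \<mu>] by (simp add: emeasure_density)
    finally show ?thesis .
  qed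
  have "incseq E" by (fastforce simp: incseq_def E_def T_def)
  then have "a * emeasure \<mu> (\<Union>n. E n) = (SUP n. a * emeasure \<mu> (E n))"
    by (subst SUP_emeasure_incseq[symmetric]) (auto simp: SUP_mult_left_ennreal)
  also have "\<dots> \<le> ennreal K * (\<integral>\<^sup>+ x. g x \<partial>\<mu>)" by (rule SUP_least) (rule E_le)
  finally show ?thesis by (simp add: E_eq)
qed

text \<open>The part of \<open>g\<close> that stays below height \<open>b\<close> contributes at
  most \<open>b\<close> to every average.\<close>

lemma maximal_fun_le_truncation:
  assumes [measurable]: "g \<in> borel_measurable \<mu>"
  shows "maximal_fun \<mu> g x \<le> maximal_fun \<mu> (\<lambda>y. g y * indicator {y. b < g y} y) x + b"
  unfolding maximal_fun_def[of _ g]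
proof (safe intro!: SUP_least)
  fix c r assume x: "x \<in> ball c r"
  then have r: "0 < r" using zero_le_dist[of c x] by (simp del: zero_le_dist)
  have "(\<integral>\<^sup>+ y\<in>ball c r. g y \<partial>\<mu>) \<le>
    (\<integral>\<^sup>+ y. g y * indicator {y. b < g y} y * indicator (ball c r) y + b * indicator (ball c r) y \<partial>\<mu>)"
    by (intro nn_integral_mono) (auto simp: indicator_def)
  also have "\<dots> = (\<integral>\<^sup>+ y\<in>ball c r. (g y * indicator {y. b < g y} y) \<partial>\<mu>) + b * emeasure \<mu> (ball c r)"
    by (subst nn_integral_add) (auto simp: nn_integral_cmult)
  finally have "(\<integral>\<^sup>+ y\<in>ball c r. g y \<partial>\<mu>) / emeasure \<mu> (ball c r) \<le>
     ((\<integral>\<^sup>+ y\<in>ball c r. (g y * indicator {y. b < g y} y) \<partial>\<mu>) + b * emeasure \<mu> (ball c r)) / emeasure \<mu> (ball c r)"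
    by (rule divide_right_mono_ennreal)
  also have "\<dots> = (\<integral>\<^sup>+ y\<in>ball c r. (g y * indicator {y. b < g y} y) \<partial>\<mu>) / emeasure \<mu> (ball c r) + b"
    using pos_ball[OF r, of c] finite_ball[OF r, of c]
    by (simp add: add_divide_distrib_ennreal mult_divide_eq_ennreal)
  also have "\<dots> \<le> maximal_fun \<mu> (\<lambda>y. g y * indicator {y. b < g y} y) x + b"
    by (intro add_right_mono maximal_fun_upper x)
  finally show "(\<integral>\<^sup>+ y\<in>ball c r. g y \<partial>\<mu>) / emeasure \<mu> (ball c r)
    \<le> maximal_fun \<mu> (\<lambda>y. g y * indicator {y. b < g y} y) x + b" .
qed

text \<open>Truncating \<open>g\<close> at height \<open>l / 2\<close> costs at most
  \<open>l / 2\<close> in the maximal function, so the weak type bound can be applied to the large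
  part of \<open>g\<close> alone, at height \<open>l / 2\<close>.\<close>

lemma emeasure_maximal_fun_greater:
  assumes [measurable]: "g \<in> borel_measurable \<mu>" and l: "0 < l"
  shows "emeasure \<mu> {x. ennreal l < maximal_fun \<mu> g x} \<le>
    ennreal (2 * K / l) * (\<integral>\<^sup>+ x. g x * indicator {x. ennreal l < 2 * g x} x \<partial>\<mu>)"
proof -
  let ?g = "\<lambda>y. g y * indicator {y. ennreal (l / 2) < g y} y"
  have eq: "ennreal (l / 2) < g y \<longleftrightarrow> ennreal l < 2 * g y" for y
    using l by (cases "g y") (auto simp: ennreal_less_iff ennreal_mult_top simp flip: ennreal_mult ennreal_numeral)
  have meas: "{x. a < maximal_fun \<mu> h x} \<in> sets \<mu>" for a h
    by (intro borel_imp_sets borel_open open_maximal_fun_greater)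
  have "emeasure \<mu> {x. ennreal l < maximal_fun \<mu> g x} \<le> emeasure \<mu> {x. ennreal (l / 2) < maximal_fun \<mu> ?g x}"
  proof (intro emeasure_mono subsetI CollectI meas)
    fix x assume "x \<in> {x. ennreal l < maximal_fun \<mu> g x}"
    then have "ennreal l < maximal_fun \<mu> ?g x + ennreal (l / 2)"
      using maximal_fun_le_truncation[of g x "ennreal (l / 2)"] by (auto intro: less_le_trans)
    then show "ennreal (l / 2) < maximal_fun \<mu> ?g x"
      using l by (cases "maximal_fun \<mu> ?g x") (auto simp: ennreal_less_iff simp flip: ennreal_plus)
  qed
  also have "\<dots> = ennreal (2 / l) * (ennreal (l / 2) * emeasure \<mu> {x. ennreal (l / 2) < maximal_fun \<mu> ?g x})"
    using l by (simp add: mult.assoc[symmetric] flip: ennreal_mult)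
  also have "\<dots> \<le> ennreal (2 / l) * (ennreal K * (\<integral>\<^sup>+ x. ?g x \<partial>\<mu>))"
    by (intro mult_left_mono weak_type) auto
  also have "\<dots> = ennreal (2 * K / l) * (\<integral>\<^sup>+ x. ?g x \<partial>\<mu>)"
    using l K_pos by (simp add: mult.assoc[symmetric] flip: ennreal_mult)
  finally show ?thesis by (simp add: eq)
qed

text \<open>Marcinkiewicz interpolation by hand: the layer-cake formula, the weak type bound for the
  truncation of \<open>g\<close> at each height, Fubini's theorem, and integration of
  \<open>l^(r-2)\<close> up to \<open>2 * g x\<close>. The last integral converges at 0 because
  \<open>r > 1\<close>; this is the source of the factor \<open>1 / (r - 1)\<close>.\<close>

theorem maximal_fun_strong_type:
  assumes [measurable]: "g \<in> borel_measurable \<mu>" and r: "1 < r"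
  shows "(\<integral>\<^sup>+ x. epow (maximal_fun \<mu> g x) r \<partial>\<mu>)
    \<le> ennreal (r * 2 powr r * K / (r - 1)) * (\<integral>\<^sup>+ x. epow (g x) r \<partial>\<mu>)"
proof -
  interpret pair_sigma_finite \<mu> "lborel :: real measure" ..
  let ?M = "maximal_fun \<mu> g"
  have [measurable]: "?M \<in> borel_measurable \<mu>"
    by (intro borel_measurable_imp borel_measurable_maximal_fun)
  have "(\<integral>\<^sup>+ x. epow (?M x) r \<partial>\<mu>) = (\<integral>\<^sup>+ x. ennreal r *
      (\<integral>\<^sup>+ l. ennreal (l powr (r - 1)) * indicator {l. 0 < l \<and> ennreal l < ?M x} l \<partial>lborel) \<partial>\<mu>)"
    using r by (subst nn_integral_powr_below) (auto simp: mult.assoc[symmetric] simp flip: ennreal_mult)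
  also have "\<dots> = ennreal r * (\<integral>\<^sup>+ x. (\<integral>\<^sup>+ l. ennreal (l powr (r - 1)) *
      indicator {(x, l). 0 < l \<and> ennreal l < ?M x} (x, l) \<partial>lborel) \<partial>\<mu>)"
    by (subst nn_integral_cmult[symmetric]) (auto simp: indicator_def)
  also have "\<dots> = ennreal r * (\<integral>\<^sup>+ l. (\<integral>\<^sup>+ x. ennreal (l powr (r - 1)) *
      indicator {(x, l). 0 < l \<and> ennreal l < ?M x} (x, l) \<partial>\<mu>) \<partial>lborel)"
    by (subst Fubini') auto
  also have "\<dots> \<le> ennreal r * (\<integral>\<^sup>+ l. (\<integral>\<^sup>+ x. ennreal (2 * K) * (g x * (ennreal (l powr (r - 1 - 1)) *
      indicator {(x, l). 0 < l \<and> ennreal l < 2 * g x} (x, l))) \<partial>\<mu>) \<partial>lborel)"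
  proof (rule mult_left_mono, rule nn_integral_mono)
    fix l :: real
    show "(\<integral>\<^sup>+ x. ennreal (l powr (r - 1)) * indicator {(x, l). 0 < l \<and> ennreal l < ?M x} (x, l) \<partial>\<mu>)
      \<le> (\<integral>\<^sup>+ x. ennreal (2 * K) * (g x * (ennreal (l powr (r - 1 - 1)) *
      indicator {(x, l). 0 < l \<and> ennreal l < 2 * g x} (x, l))) \<partial>\<mu>)"
    proof (cases "0 < l")
      case True
      have "(\<integral>\<^sup>+ x. ennreal (l powr (r - 1)) * indicator {(x, l). 0 < l \<and> ennreal l < ?M x} (x, l) \<partial>\<mu>)
        = (\<integral>\<^sup>+ x. ennreal (l powr (r - 1)) * indicator {x. ennreal l < ?M x} x \<partial>\<mu>)"
        using True by (auto simp: indicator_def)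
      also have "\<dots> = ennreal (l powr (r - 1)) * emeasure \<mu> {x. ennreal l < ?M x}"
        by (intro nn_integral_cmult_indicator borel_imp_sets borel_open open_maximal_fun_greater)
      also have "\<dots> \<le> ennreal (l powr (r - 1)) *
          (ennreal (2 * K / l) * (\<integral>\<^sup>+ x. g x * indicator {x. ennreal l < 2 * g x} x \<partial>\<mu>))"
        using True by (intro mult_left_mono emeasure_maximal_fun_greater) auto
      also have "\<dots> = ennreal (2 * K) * (ennreal (l powr (r - 1 - 1)) *
          (\<integral>\<^sup>+ x. g x * indicator {x. ennreal l < 2 * g x} x \<partial>\<mu>))"
      proof -
        have "l powr (r - 1) * (2 * K / l) = 2 * K * l powr (r - 1 - 1)"
          using True powr_diff[of l "r - 1" 1] by (simp add: field_simps)
        then show ?thesis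
          using True K_pos by (simp add: mult.assoc[symmetric] flip: ennreal_mult)
      qed
      also have "\<dots> = (\<integral>\<^sup>+ x. ennreal (2 * K) * (g x * (ennreal (l powr (r - 1 - 1)) *
      indicator {(x, l). 0 < l \<and> ennreal l < 2 * g x} (x, l))) \<partial>\<mu>)"
      proof -
        have "(\<integral>\<^sup>+ x. ennreal (2 * K) * (g x * (ennreal (l powr (r - 1 - 1)) *
            indicator {(x, l). 0 < l \<and> ennreal l < 2 * g x} (x, l))) \<partial>\<mu>)
          = (\<integral>\<^sup>+ x. ennreal (2 * K) * (ennreal (l powr (r - 1 - 1)) *
            (g x * indicator {x. ennreal l < 2 * g x} x)) \<partial>\<mu>)"
          using True by (intro nn_integral_cong) (auto simp: indicator_def mult_ac)
        then show ?thesis by (simp add: nn_integral_cmult)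
      qed
      finally show ?thesis .
    qed simp
  qed auto
  \<comment> \<open>The second exchange of integrals: for fixed \<open>x\<close> the heights now run
    over \<open>0 < l < 2 * g x\<close>. The exponent \<open>r - 1 - 1\<close> is kept in the shape
    \<open>e - 1\<close> with \<open>e = r - 1\<close> for
    \<open>nn_integral_powr_below\<close>.\<close>
  also have "\<dots> = ennreal r * (\<integral>\<^sup>+ x. (\<integral>\<^sup>+ l. ennreal (2 * K) * (g x * (ennreal (l powr (r - 1 - 1)) *
      indicator {(x, l). 0 < l \<and> ennreal l < 2 * g x} (x, l))) \<partial>lborel) \<partial>\<mu>)"
    by (subst Fubini') auto
  also have "\<dots> = ennreal r * (\<integral>\<^sup>+ x. ennreal (2 * K) * (g x *
     (\<integral>\<^sup>+ l. (ennreal (l powr (r - 1 - 1)) * indicator {l. 0 < l \<and> ennreal l < 2 * g x} l) \<partial>lborel)) \<partial>\<mu>)"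
    by (simp add: nn_integral_cmult indicator_def)
  also have "\<dots> = ennreal r * (\<integral>\<^sup>+ x. ennreal (2 * K) * (g x * (ennreal (1 / (r - 1)) * epow (2 * g x) (r - 1))) \<partial>\<mu>)"
    using r by (subst nn_integral_powr_below) auto
  also have "\<dots> = ennreal r * (\<integral>\<^sup>+ x. ennreal (2 powr r * K / (r - 1)) * epow (g x) r \<partial>\<mu>)"
  proof (intro arg_cong[where f="\<lambda>z. ennreal r * z"] nn_integral_cong)
    fix x
    have "epow (2 * g x) (r - 1) = ennreal (2 powr (r - 1)) * epow (g x) (r - 1)"
      using r epow_ennreal[of 2 "r - 1"] by (subst epow_mult) auto
    then have "ennreal (2 * K) * (g x * (ennreal (1 / (r - 1)) * epow (2 * g x) (r - 1))) =
        (ennreal (2 * K) * (ennreal (1 / (r - 1)) * ennreal (2 powr (r - 1)))) * (g x * epow (g x) (r - 1))"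
      by (simp only: mult_ac)
    also have "g x * epow (g x) (r - 1) = epow (g x) r"
      using epow_add[of 1 "r - 1" "g x"] r by simp
    also have "ennreal (2 * K) * (ennreal (1 / (r - 1)) * ennreal (2 powr (r - 1))) =
        ennreal (2 * K * (1 / (r - 1) * 2 powr (r - 1)))"
      using r K_pos by (simp add: ennreal_mult del: times_divide_eq_left times_divide_eq_right)
    also have "2 * K * (1 / (r - 1) * 2 powr (r - 1)) = 2 powr r * K / (r - 1)"
      using r by (simp add: powr_diff field_simps)
    finally show "ennreal (2 * K) * (g x * (ennreal (1 / (r - 1)) * epow (2 * g x) (r - 1))) =
       ennreal (2 powr r * K / (r - 1)) * epow (g x) r" .
  qed
  also have "\<dots> = ennreal (r * 2 powr r * K / (r - 1)) * (\<integral>\<^sup>+ x. epow (g x) r \<partial>\<mu>)"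
    using r K_pos by (simp add: nn_integral_cmult mult.assoc[symmetric] flip: ennreal_mult)
  finally show ?thesis .
qed

end

section \<open>Weights of class \<open>A(P,Q)\<close>\<close>

text \<open>The exponent \<open>d = 1 - \<beta>/n\<close> gives the uncentred fractional maximal
  function of order \<beta>; \<open>d = 1\<close> is the Hardy-Littlewood case.\<close>

definition frac_maximal_fun :: "real \<Rightarrow> ('a::euclidean_space \<Rightarrow> ennreal) \<Rightarrow> 'a \<Rightarrow> ennreal"
  where "frac_maximal_fun d F x = (SUP (c, r) \<in> {(c, r). x \<in> ball c r}.
    (\<integral>\<^sup>+ y\<in>ball c r. F y \<partial>lebesgue) / epow (emeasure lebesgue (ball c r)) d)"

lemma frac_maximal_fun_upper:
  "x \<in> ball c r \<Longrightarrow>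
    (\<integral>\<^sup>+ y\<in>ball c r. F y \<partial>lebesgue) / epow (emeasure lebesgue (ball c r)) d \<le> frac_maximal_fun d F x"
  unfolding frac_maximal_fun_def by (rule SUP_upper2[where i="(c, r)"]) auto

lemma borel_measurable_frac_maximal_fun [measurable]: "frac_maximal_fun d F \<in> borel_measurable borel"
proof (rule borel_measurableI_greater)
  fix a :: ennreal
  have "{x. a < frac_maximal_fun d F x} =
      (\<Union>(c, r)\<in>{(c, r). a < (\<integral>\<^sup>+ y\<in>ball c r. F y \<partial>lebesgue) / epow (emeasure lebesgue (ball c r)) d}. ball c r)"
    by (force simp: frac_maximal_fun_def less_SUP_iff)
  moreover have "open \<dots>" by auto
  ultimately show "{x \<in> space borel. a < frac_maximal_fun d F x} \<in> sets borel" by simp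
qed

lemma sets_lebesgue_ball [measurable]: "ball c r \<in> sets lebesgue" "cball c r \<in> sets lebesgue"
  by simp_all

lemma measure_lebesgue_ball_scale:
  fixes c :: "'a::euclidean_space"
  assumes "0 < r" "0 < k"
  shows "measure lebesgue (ball c (k * r)) = k powr real DIM('a) * measure lebesgue (ball c r)"
  using assms by (simp add: content_ball power_mult_distrib powr_realpow)

text \<open>Allows division by weighted measures of balls: a positive integrand with integral 0
  would make the ball a null set.\<close>

lemma set_nn_integral_powr_pos:
  fixes W :: "'a::euclidean_space \<Rightarrow> real"
  assumes [measurable]: "W \<in> borel_measurable lebesgue" and W_pos: "\<And>x. 0 < W x" and r: "0 < r"
  shows "0 < (\<integral>\<^sup>+ x\<in>ball c r. ennreal (W x powr e) \<partial>lebesgue)"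
proof (rule ccontr)
  assume "\<not> ?thesis"
  then have "AE x in lebesgue. ennreal (W x powr e) * indicator (ball c r) x = 0"
    by (subst (asm) not_gr_zero, subst (asm) nn_integral_0_iff_AE) auto
  then have "AE x in lebesgue. x \<notin> ball c r"
    by eventually_elim (use W_pos in \<open>auto simp: indicator_def less_imp_neq[symmetric] split: if_splits\<close>)
  then have "emeasure lebesgue (ball c r) = 0"
    by (subst (asm) AE_iff_measurable[of "ball c r"]) auto
  then show False using content_ball_pos[OF r, of c] by (simp add: measure_def)
qed

text \<open>The weight is real and strictly positive everywhere, so its powers are ordinary real
  powers, and with \<open>finite_V\<close> and \<open>finite_S\<close> the weighted measures of
  balls are positive reals. \<open>Apq\<close> is the \<open>A(P,Q)\<close> condition with the
  averages multiplied out, which collects the powers of the volume to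
  \<open>1/Q + 1/P'\<close>.\<close>

locale apq_weight =
  fixes W :: "'a::euclidean_space \<Rightarrow> real" and P Q A :: real
  assumes measurable_W [measurable]: "W \<in> borel_measurable lebesgue"
    and W_pos: "0 < W x"
    and P_gt_1: "1 < P" and P_less_Q: "P < Q" and A_pos: "0 < A"
    and finite_V: "0 < r \<Longrightarrow> (\<integral>\<^sup>+ x\<in>ball c r. ennreal (W x powr Q) \<partial>lebesgue) < \<infinity>"
    and finite_S: "0 < r \<Longrightarrow> (\<integral>\<^sup>+ x\<in>ball c r. ennreal (W x powr - (P / (P - 1))) \<partial>lebesgue) < \<infinity>"
    and Apq: "0 < r \<Longrightarrow>
      epow (\<integral>\<^sup>+ x\<in>ball c r. ennreal (W x powr Q) \<partial>lebesgue) (1 / Q)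
      * epow (\<integral>\<^sup>+ x\<in>ball c r. ennreal (W x powr - (P / (P - 1))) \<partial>lebesgue) (1 - 1 / P)
      \<le> ennreal A * epow (emeasure lebesgue (ball c r)) (1 / Q + 1 - 1 / P)"
begin

section \<open>Exponents, the measures \<open>V\<close> and \<open>S\<close>, and the two-sided
  \<open>A(P,Q)\<close> relation on balls\<close>

definition "P' = P / (P - 1)"
definition "d = 1 / Q + 1 / P'"
text \<open>The Lebesgue exponent used for the maximal operator of \<open>V\<close>. It satisfies
  \<open>- Q * \<rho> + Q = - P'\<close>, which turns the density of \<open>V\<close> into that of
  \<open>S\<close>, and also \<open>\<rho> = d * P'\<close>.\<close>

definition "\<rho> = 1 + P' / Q"
definition "V = density lebesgue (\<lambda>x. ennreal (W x powr Q))"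
definition "S = density lebesgue (\<lambda>x. ennreal (W x powr - P'))"

abbreviation "leb c r \<equiv> measure lebesgue (ball (c::'a) r)"

lemma exps:
  shows P'_gt_1: "1 < P'" and Q_pos: "0 < Q" and P_pos: "0 < P" and P'_eq: "1 / P' = 1 - 1 / P"
    and d_pos: "0 < d" and \<rho>_gt_1: "1 < \<rho>" and \<rho>_eq: "\<rho> = d * P'" and P'P: "P' * (P - 1) = P"
proof -
  show 1: "1 < P'" "0 < Q" "0 < P" "1 / P' = 1 - 1 / P" "P' * (P - 1) = P"
    using P_gt_1 P_less_Q by (auto simp: P'_def field_simps)
  show "0 < d" unfolding d_def using 1(1,2) by (intro add_pos_pos) auto
  show "1 < \<rho>" "\<rho> = d * P'" using 1(1,2) by (auto simp: \<rho>_def d_def field_simps)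
qed

lemma sets_VS [simp, measurable_cong]: "sets V = sets lebesgue" "sets S = sets lebesgue"
  by (auto simp: V_def S_def)

lemma nn_integral_V:
  "f \<in> borel_measurable lebesgue \<Longrightarrow> (\<integral>\<^sup>+ x. f x \<partial>V) = (\<integral>\<^sup>+ x. f x * ennreal (W x powr Q) \<partial>lebesgue)"
  unfolding V_def by (subst nn_integral_density) (auto simp: mult.commute)

lemma nn_integral_S:
  "f \<in> borel_measurable lebesgue \<Longrightarrow> (\<integral>\<^sup>+ x. f x \<partial>S) = (\<integral>\<^sup>+ x. f x * ennreal (W x powr - P') \<partial>lebesgue)"
  unfolding S_def by (subst nn_integral_density) (auto simp: mult.commute)

lemma emeasure_V: "X \<in> sets lebesgue \<Longrightarrow> emeasure V X = (\<integral>\<^sup>+ x\<in>X. ennreal (W x powr Q) \<partial>lebesgue)"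
  unfolding V_def by (simp add: emeasure_density)

lemma emeasure_S: "X \<in> sets lebesgue \<Longrightarrow> emeasure S X = (\<integral>\<^sup>+ x\<in>X. ennreal (W x powr - P') \<partial>lebesgue)"
  unfolding S_def by (simp add: emeasure_density)

lemma leb_pos: "0 < r \<Longrightarrow> 0 < leb c r"
  by (simp add: content_ball_pos)

lemma emeasure_leb: "0 < r \<Longrightarrow> emeasure lebesgue (ball (c::'a) r) = ennreal (leb c r)"
  by (simp add: emeasure_eq_measure2 emeasure_lborel_ball_finite less_top[symmetric] emeasure_eq_ennreal_measure)

lemma emeasure_V_ball:
  assumes "0 < r"
  shows "emeasure V (ball c r) = ennreal (measure V (ball c r))" "0 < measure V (ball c r)"
proof -
  have "emeasure V (ball c r) < top" "0 < emeasure V (ball c r)"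
    using finite_V[OF assms, of c] set_nn_integral_powr_pos[OF measurable_W W_pos assms] by (auto simp: emeasure_V)
  then show "emeasure V (ball c r) = ennreal (measure V (ball c r))" "0 < measure V (ball c r)"
    by (auto simp: measure_def enn2real_positive_iff)
qed

lemma emeasure_S_ball:
  assumes "0 < r"
  shows "emeasure S (ball c r) = ennreal (measure S (ball c r))" "0 < measure S (ball c r)"
proof -
  have "emeasure S (ball c r) < top" "0 < emeasure S (ball c r)"
    using finite_S[OF assms, of c] set_nn_integral_powr_pos[OF measurable_W W_pos assms] by (auto simp: emeasure_S P'_def)
  then show "emeasure S (ball c r) = ennreal (measure S (ball c r))" "0 < measure S (ball c r)"
    by (auto simp: measure_def enn2real_positive_iff)
qed

lemma Apq_real:
  assumes r: "0 < r"
  shows "measure V (ball c r) powr (1 / Q) * measure S (ball c r) powr (1 / P') \<le> A * leb c r powr d"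
proof -
  have "epow (emeasure V (ball c r)) (1 / Q) * epow (emeasure S (ball c r)) (1 / P')
      \<le> ennreal A * epow (emeasure lebesgue (ball c r)) d"
    using Apq[OF r, of c] by (simp add: emeasure_V emeasure_S d_def P'_eq) (simp add: P'_def algebra_simps)
  then show ?thesis
    using A_pos emeasure_V_ball[OF r, of c] emeasure_S_ball[OF r, of c] leb_pos[OF r, of c]
    by (simp add: emeasure_leb[OF r] epow_ennreal flip: ennreal_mult)
qed

text \<open>Hoelder's inequality for the constant \<open>1 = (W^Q)^x (W^-P')^y\<close>. With
  \<open>Apq_real\<close> it makes both sides comparable, and this is the source of the doubling
  property.\<close>

lemma Apq_reverse:
  assumes r: "0 < r"
  shows "leb c r powr d \<le> measure V (ball c r) powr (1 / Q) * measure S (ball c r) powr (1 / P')"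
proof -
  \<comment> \<open>Chosen so that \<open>Q * x = P' * y\<close>, which cancels the powers of
    \<open>W\<close>; the definition of \<open>d\<close> gives \<open>x + y = 1\<close>.\<close>
  define x where "x = 1 / (Q * d)"
  define y where "y = 1 / (P' * d)"
  have xy: "0 < x" "0 < y" "x + y = 1"
  proof -
    have "x + y = (1 / Q + 1 / P') / d" by (simp add: x_def y_def add_divide_distrib)
    then show "x + y = 1" using d_pos by (simp flip: d_def)
  qed (use exps in \<open>auto simp: x_def y_def\<close>)
  have "emeasure lebesgue (ball c r) = (\<integral>\<^sup>+ t\<in>ball c r. 1 \<partial>lebesgue)" by simp
  also have "\<dots> = (\<integral>\<^sup>+ t\<in>ball c r. (epow (ennreal (W t powr Q)) x * epow (ennreal (W t powr - P')) y) \<partial>lebesgue)"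
  proof (intro nn_integral_cong)
    fix t
    have "epow (ennreal (W t powr Q)) x * epow (ennreal (W t powr - P')) y = ennreal (W t powr (Q * x + - P' * y))"
      using W_pos[of t] by (simp add: epow_ennreal powr_powr flip: ennreal_mult powr_add)
    also have "Q * x + - P' * y = 0" using exps by (simp add: x_def y_def)
    finally show "1 * indicator (ball c r) t = epow (ennreal (W t powr Q)) x * epow (ennreal (W t powr - P')) y * indicator (ball c r) t"
      using W_pos[of t] by simp
  qed
  also have "\<dots> \<le> epow (\<integral>\<^sup>+ t\<in>ball c r. ennreal (W t powr Q) \<partial>lebesgue) x * epow (\<integral>\<^sup>+ t\<in>ball c r. ennreal (W t powr - P') \<partial>lebesgue) y"
    by (intro nn_integral_Holder_set xy) auto
  finally have "leb c r \<le> measure V (ball c r) powr x * measure S (ball c r) powr y"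
    using emeasure_V_ball[OF r, of c] emeasure_S_ball[OF r, of c]
    by (simp add: emeasure_leb[OF r] epow_ennreal flip: ennreal_mult emeasure_V emeasure_S)
  then have "leb c r powr d \<le> (measure V (ball c r) powr x * measure S (ball c r) powr y) powr d"
    using leb_pos[OF r] d_pos by (intro powr_mono2) auto
  also have "\<dots> = measure V (ball c r) powr (1 / Q) * measure S (ball c r) powr (1 / P')"
    using exps by (simp add: powr_mult powr_powr x_def y_def)
  finally show ?thesis .
qed

section \<open>Doubling of \<open>V\<close> and \<open>S\<close>\<close>

lemma measure_mono_ball:
  assumes "0 < r" "r \<le> r'"
  shows "measure V (ball c r) \<le> measure V (ball c r')" "measure S (ball c r) \<le> measure S (ball c r')"
  using assms by (auto intro!: measure_mono_fmeasurable fmeasurableI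
      simp: emeasure_V_ball emeasure_S_ball subset_ball)

definition "dilation_const k = A * (k powr real DIM('a)) powr d"

lemma dilation_const_pos: "0 < k \<Longrightarrow> 0 < dilation_const k"
  using A_pos by (simp add: dilation_const_def)

text \<open>The upper bound is used on the large ball and the reverse bound on the small one.
  Volumes scale by \<open>k^n\<close>, which explains the factor \<open>k^(n d)\<close> in
  \<open>dilation_const k\<close>.\<close>

lemma Apq_dilate:
  assumes r: "0 < r" and k: "1 \<le> k"
  shows "measure V (ball c (k * r)) powr (1 / Q) * measure S (ball c (k * r)) powr (1 / P') \<le>
    dilation_const k * (measure V (ball c r) powr (1 / Q) * measure S (ball c r) powr (1 / P'))"
proof -
  have "measure V (ball c (k * r)) powr (1 / Q) * measure S (ball c (k * r)) powr (1 / P') \<le> A * leb c (k * r) powr d"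
    using r k by (intro Apq_real) auto
  also have "\<dots> = dilation_const k * leb c r powr d"
    using r k by (subst measure_lebesgue_ball_scale) (auto simp: powr_mult dilation_const_def)
  also have "\<dots> \<le> dilation_const k * (measure V (ball c r) powr (1 / Q) * measure S (ball c r) powr (1 / P'))"
    using r k dilation_const_pos[of k] by (intro mult_left_mono Apq_reverse) auto
  finally show ?thesis .
qed

text \<open>The dilation inequality controls only a product. Since \<open>S\<close> grows with the
  ball, its factor on the right may be enlarged to the big ball and cancelled, which leaves a bound
  for \<open>V\<close> alone.\<close>

lemma doubling_V:
  assumes r: "0 < r" and k: "1 \<le> k"
  shows "measure V (ball c (k * r)) \<le> dilation_const k powr Q * measure V (ball c r)"
proof -
  let ?v = "measure V (ball c r)" and ?v' = "measure V (ball c (k * r))"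
  let ?s = "measure S (ball c r)" and ?s' = "measure S (ball c (k * r))"
  have kr: "0 < k * r" "r \<le> k * r" using r k by auto
  have "?v' powr (1 / Q) * ?s' powr (1 / P') \<le> dilation_const k * (?v powr (1 / Q) * ?s powr (1 / P'))"
    by (rule Apq_dilate) fact+
  also have "\<dots> \<le> dilation_const k * (?v powr (1 / Q) * ?s' powr (1 / P'))"
    using dilation_const_pos[of k] k P'_gt_1 Q_pos by (intro mult_left_mono powr_mono2 measure_mono_ball r kr) auto
  finally have "?v' powr (1 / Q) \<le> dilation_const k * ?v powr (1 / Q)"
    using emeasure_S_ball(2)[OF kr(1), of c] by (simp flip: mult.assoc)
  then have "(?v' powr (1 / Q)) powr Q \<le> (dilation_const k * ?v powr (1 / Q)) powr Q"
    using Q_pos by (intro powr_mono2) auto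
  then show ?thesis
    using Q_pos dilation_const_pos[of k] k emeasure_V_ball(2)[OF kr(1), of c] emeasure_V_ball(2)[OF r, of c]
    by (simp add: powr_powr powr_mult)
qed

text \<open>The same cancellation with the factors of \<open>V\<close> and \<open>S\<close>
  exchanged.\<close>

lemma doubling_S:
  assumes r: "0 < r" and k: "1 \<le> k"
  shows "measure S (ball c (k * r)) \<le> dilation_const k powr P' * measure S (ball c r)"
proof -
  let ?v = "measure V (ball c r)" and ?v' = "measure V (ball c (k * r))"
  let ?s = "measure S (ball c r)" and ?s' = "measure S (ball c (k * r))"
  have kr: "0 < k * r" "r \<le> k * r" using r k by auto
  have "?v' powr (1 / Q) * ?s' powr (1 / P') \<le> dilation_const k * (?v powr (1 / Q) * ?s powr (1 / P'))"
    by (rule Apq_dilate) fact+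
  also have "\<dots> \<le> dilation_const k * (?v' powr (1 / Q) * ?s powr (1 / P'))"
    using dilation_const_pos[of k] k P'_gt_1 Q_pos by (intro mult_left_mono mult_right_mono powr_mono2 measure_mono_ball r kr) auto
  finally have "?v' powr (1 / Q) * ?s' powr (1 / P') \<le> ?v' powr (1 / Q) * (dilation_const k * ?s powr (1 / P'))"
    by (simp add: mult_ac)
  then have "?s' powr (1 / P') \<le> dilation_const k * ?s powr (1 / P')"
    using emeasure_V_ball(2)[OF kr(1), of c] by simp
  then have "(?s' powr (1 / P')) powr P' \<le> (dilation_const k * ?s powr (1 / P')) powr P'"
    using P'_gt_1 by (intro powr_mono2) auto
  then show ?thesis
    using P'_gt_1 dilation_const_pos[of k] k emeasure_S_ball(2)[OF kr(1), of c] emeasure_S_ball(2)[OF r, of c]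
    by (simp add: powr_powr powr_mult)
qed

text \<open>The dilation is 6, not 5, because the closed ball of radius \<open>5 * r\<close> has to
  fit into an open ball.\<close>

lemma doubling_measure_V: "doubling_measure V (dilation_const 6 powr Q)"
proof
  fix c :: 'a and r :: real assume r: "0 < r"
  show "emeasure V (ball c r) < \<infinity>" "0 < emeasure V (ball c r)"
    using emeasure_V_ball[OF r, of c] by auto
  have "emeasure V (cball c (5 * r)) \<le> emeasure V (ball c (6 * r))"
    using r by (intro emeasure_mono) auto
  also have "\<dots> = ennreal (measure V (ball c (6 * r)))" using r by (intro emeasure_V_ball) auto
  also have "\<dots> \<le> ennreal (dilation_const 6 powr Q * measure V (ball c r))"
    using doubling_V[OF r, of 6 c] by (intro ennreal_leI) auto
  finally show "emeasure V (cball c (5 * r)) \<le> ennreal (dilation_const 6 powr Q) * emeasure V (ball c r)"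
    by (simp add: emeasure_V_ball(1)[OF r] ennreal_mult)
qed (use dilation_const_pos[of 6] in auto)

lemma doubling_measure_S: "doubling_measure S (dilation_const 6 powr P')"
proof
  fix c :: 'a and r :: real assume r: "0 < r"
  show "emeasure S (ball c r) < \<infinity>" "0 < emeasure S (ball c r)"
    using emeasure_S_ball[OF r, of c] by auto
  have "emeasure S (cball c (5 * r)) \<le> emeasure S (ball c (6 * r))"
    using r by (intro emeasure_mono) auto
  also have "\<dots> = ennreal (measure S (ball c (6 * r)))" using r by (intro emeasure_S_ball) auto
  also have "\<dots> \<le> ennreal (dilation_const 6 powr P' * measure S (ball c r))"
    using doubling_S[OF r, of 6 c] by (intro ennreal_leI) auto
  finally show "emeasure S (cball c (5 * r)) \<le> ennreal (dilation_const 6 powr P') * emeasure S (ball c r)"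
    by (simp add: emeasure_S_ball(1)[OF r] ennreal_mult)
qed (use dilation_const_pos[of 6] in auto)

section \<open>The strong type bound for the fractional maximal operator\<close>

lemma measurable_VS:
  "f \<in> borel_measurable lebesgue \<Longrightarrow> f \<in> borel_measurable V"
  "f \<in> borel_measurable lebesgue \<Longrightarrow> f \<in> borel_measurable S"
  by (auto cong: measurable_cong_sets)

lemma measurable_maximal_fun [measurable]: "maximal_fun \<mu> g \<in> borel_measurable lebesgue"
  by (rule measurable_completion) simp

lemma measurable_frac_maximal_fun [measurable]: "frac_maximal_fun e F \<in> borel_measurable lebesgue"
  by (rule measurable_completion) simp

text \<open>Inserts \<open>W * W^-1\<close> and applies Hoelder's inequality with the exponents
  \<open>P\<close> and \<open>P'\<close>.\<close>

lemma Holder_ball: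
  assumes [measurable]: "F \<in> borel_measurable lebesgue" and r: "0 < r"
  shows "(\<integral>\<^sup>+ x\<in>ball c r. F x \<partial>lebesgue) \<le>
    epow (\<integral>\<^sup>+ x\<in>ball c r. epow (F x) P * ennreal (W x powr P) \<partial>lebesgue) (1 / P)
    * ennreal (measure S (ball c r) powr (1 / P'))"
proof -
  have "(\<integral>\<^sup>+ x\<in>ball c r. F x \<partial>lebesgue) = (\<integral>\<^sup>+ x\<in>ball c r.
      (epow (epow (F x) P * ennreal (W x powr P)) (1 / P) * epow (ennreal (W x powr - P')) (1 / P')) \<partial>lebesgue)"
  proof (intro nn_integral_cong arg_cong2[where f="(*)"] refl)
    fix x
    have "epow (epow (F x) P * ennreal (W x powr P)) (1 / P) * epow (ennreal (W x powr - P')) (1 / P')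
      = F x * (ennreal (W x powr 1) * ennreal (W x powr - 1))"
      using P_pos P'_gt_1 W_pos[of x] by (simp add: epow_mult epow_epow epow_ennreal powr_powr mult.assoc)
    also have "\<dots> = F x"
      using W_pos[of x] by (simp flip: ennreal_mult powr_add)
    finally show "F x = epow (epow (F x) P * ennreal (W x powr P)) (1 / P) * epow (ennreal (W x powr - P')) (1 / P')" ..
  qed
  also have "\<dots> \<le> epow (\<integral>\<^sup>+ x\<in>ball c r. (epow (F x) P * ennreal (W x powr P)) \<partial>lebesgue) (1 / P)
      * epow (\<integral>\<^sup>+ x\<in>ball c r. ennreal (W x powr - P') \<partial>lebesgue) (1 / P')"
    using P_pos P_gt_1 P'_gt_1 P'_eq by (intro nn_integral_Holder_set) auto
  also have "(\<integral>\<^sup>+ x\<in>ball c r. ennreal (W x powr - P') \<partial>lebesgue) = ennreal (measure S (ball c r))"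
    using emeasure_S_ball(1)[OF r, of c] by (simp add: emeasure_S)
  also have "epow \<dots> (1 / P') = ennreal (measure S (ball c r) powr (1 / P'))"
    using emeasure_S_ball(2)[OF r, of c] by (simp add: epow_ennreal)
  finally show ?thesis .
qed

text \<open>This is the \<open>A(P,Q)\<close> bound raised to the power \<rho>:
  \<open>\<rho> / P' = d\<close> produces the power of the \<open>S\<close>-measure, and
  \<open>d * \<rho> = \<rho> / Q + d\<close> leaves the power \<open>\<rho> / Q\<close> of the
  quotient.\<close>

lemma pointwise_exponents:
  assumes r: "0 < r"
  shows "measure S (ball c r) powr d / leb c r powr d \<le>
    A powr \<rho> * (leb c r / measure V (ball c r)) powr (\<rho> / Q)"
proof -
  let ?v = "measure V (ball c r)" and ?s = "measure S (ball c r)" and ?l = "leb c r"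
  have pos: "0 < ?v" "0 < ?s" "0 < ?l"
    using emeasure_V_ball(2)[OF r] emeasure_S_ball(2)[OF r] leb_pos[OF r] by auto
  have "?s powr (1 / P') \<le> A * ?l powr d / ?v powr (1 / Q)"
    using Apq_real[OF r, of c] pos by (simp add: field_simps)
  then have "(?s powr (1 / P')) powr \<rho> \<le> (A * ?l powr d / ?v powr (1 / Q)) powr \<rho>"
    using \<rho>_gt_1 by (intro powr_mono2) auto
  moreover have "(?s powr (1 / P')) powr \<rho> = ?s powr d"
    using P'_gt_1 by (simp add: powr_powr \<rho>_eq)
  moreover have "(A * ?l powr d / ?v powr (1 / Q)) powr \<rho> = A powr \<rho> * ?l powr (d * \<rho>) / ?v powr (\<rho> / Q)"
    using pos A_pos by (simp add: powr_mult powr_divide powr_powr)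
  moreover have "d * \<rho> = \<rho> / Q + d"
  proof -
    have "d * \<rho> = d * P' / Q + d" by (simp add: \<rho>_def algebra_simps)
    then show ?thesis by (simp add: \<rho>_eq)
  qed
  ultimately have "?s powr d \<le> A powr \<rho> * (?l powr (\<rho> / Q) * ?l powr d) / ?v powr (\<rho> / Q)"
    by (simp add: powr_add)
  then show ?thesis
    using pos by (simp add: powr_divide field_simps)
qed

text \<open>For a ball containing \<open>x\<close>, the integral \<open>I\<close> of
  \<open>F\<close> is factored as \<open>I^(P/Q) I^(1-P/Q)\<close>. Hoelder's inequality for the
  second factor yields the power of \<open>J\<close>. The first factor is controlled by an average
  over \<open>S\<close>, which bounds the maximal function of \<open>S\<close> from below on the
  ball and is then averaged over \<open>V\<close>.\<close>

lemma frac_maximal_fun_pointwise: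
  assumes [measurable]: "F \<in> borel_measurable lebesgue"
  defines "J \<equiv> \<integral>\<^sup>+ x. epow (F x) P * ennreal (W x powr P) \<partial>lebesgue"
  defines "g \<equiv> \<lambda>x. F x * ennreal (W x powr P')"
  defines "h \<equiv> \<lambda>x. epow (maximal_fun S g x) (P / \<rho>) * ennreal (W x powr - Q)"
  shows "frac_maximal_fun d F x \<le>
    ennreal (A powr \<rho>) * epow J ((1 - P / Q) / P) * epow (maximal_fun V h x) (\<rho> / Q)"
  unfolding frac_maximal_fun_def
proof (safe intro!: SUP_least)
  fix c r assume x: "x \<in> ball c r"
  then have r: "0 < r" using zero_le_dist[of c x] by (simp del: zero_le_dist)
  have [measurable]: "g \<in> borel_measurable lebesgue" "h \<in> borel_measurable lebesgue"
    unfolding g_def h_def by measurable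
  let ?B = "ball c r" and ?\<theta> = "\<rho> / Q" and ?e = "1 - P / Q"
  define v where "v = measure V ?B"
  define s where "s = measure S ?B"
  define l where "l = leb c r"
  have pos: "0 < v" "0 < s" "0 < l"
    using emeasure_V_ball(2)[OF r] emeasure_S_ball(2)[OF r] leb_pos[OF r] by (auto simp: v_def s_def l_def)
  have em: "emeasure V ?B = ennreal v" "emeasure S ?B = ennreal s" "emeasure lebesgue ?B = ennreal l"
    using emeasure_V_ball(1)[OF r] emeasure_S_ball(1)[OF r] emeasure_leb[OF r] by (auto simp: v_def s_def l_def)
  define I where "I = (\<integral>\<^sup>+ y\<in>?B. F y \<partial>lebesgue)"
  \<comment> \<open>The \<open>S\<close>-average of \<open>g\<close> over the ball, because
    \<open>g\<close> times the density of \<open>S\<close> is \<open>F\<close>.\<close>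
  define a where "a = I / ennreal s"
  have e: "0 < ?e" using P_less_Q Q_pos by simp
  have "(\<integral>\<^sup>+ y\<in>?B. g y \<partial>S) = I"
  proof -
    have "(\<integral>\<^sup>+ y\<in>?B. g y \<partial>S) = (\<integral>\<^sup>+ y. F y * indicator ?B y * (ennreal (W y powr P') * ennreal (W y powr - P')) \<partial>lebesgue)"
      by (subst nn_integral_S) (auto simp: g_def mult_ac)
    also have "\<dots> = I"
      unfolding I_def using W_pos by (intro nn_integral_cong) (auto simp: less_imp_neq[symmetric] simp flip: ennreal_mult powr_add)
    finally show ?thesis .
  qed
  then have a_le: "a \<le> maximal_fun S g y" if "y \<in> ?B" for y
    using maximal_fun_upper[OF that, where g=g and \<mu>=S] by (simp add: a_def em)
  \<comment> \<open>The number \<open>a\<close> is at most \<open>maximal_fun S g\<close> throughout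
    the ball. The factor \<open>W^-Q\<close> in \<open>h\<close> cancels the density of
    \<open>V\<close>, so a Lebesgue integral turns into a \<open>V\<close>-integral of
    \<open>h\<close>.\<close>
  have "epow a (P / \<rho>) * ennreal l = (\<integral>\<^sup>+ y\<in>?B. epow a (P / \<rho>) \<partial>lebesgue)"
    by (simp add: nn_integral_cmult em)
  also have "\<dots> \<le> (\<integral>\<^sup>+ y\<in>?B. epow (maximal_fun S g y) (P / \<rho>) \<partial>lebesgue)"
    using P_pos \<rho>_gt_1 by (intro nn_integral_mono) (auto simp: indicator_def intro!: epow_mono a_le)
  also have "\<dots> = (\<integral>\<^sup>+ y\<in>?B. h y \<partial>V)"
  proof -
    have "(\<integral>\<^sup>+ y\<in>?B. h y \<partial>V) = (\<integral>\<^sup>+ y. epow (maximal_fun S g y) (P / \<rho>) * indicator ?B y * (ennreal (W y powr - Q) * ennreal (W y powr Q)) \<partial>lebesgue)"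
      by (subst nn_integral_V) (auto simp: h_def mult_ac)
    also have "\<dots> = (\<integral>\<^sup>+ y\<in>?B. epow (maximal_fun S g y) (P / \<rho>) \<partial>lebesgue)"
      using W_pos by (intro nn_integral_cong) (auto simp: less_imp_neq[symmetric] simp flip: ennreal_mult powr_add)
    finally show ?thesis ..
  qed
  finally have "epow a (P / \<rho>) * ennreal l / ennreal v \<le> (\<integral>\<^sup>+ y\<in>?B. h y \<partial>V) / emeasure V ?B"
    unfolding em by (rule divide_right_mono_ennreal)
  also have "\<dots> \<le> maximal_fun V h x" by (rule maximal_fun_upper[OF x])
  finally have "epow (epow a (P / \<rho>) * ennreal (l / v)) ?\<theta> \<le> epow (maximal_fun V h x) ?\<theta>"
    using pos Q_pos \<rho>_gt_1 by (intro epow_mono) (auto simp: divide_ennreal simp flip: ennreal_times_divide)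
  then have M: "epow a (P / Q) * ennreal ((l / v) powr ?\<theta>) \<le> epow (maximal_fun V h x) ?\<theta>"
    using pos Q_pos \<rho>_gt_1 by (simp add: epow_mult epow_epow epow_ennreal)
  have "I \<le> epow J (1 / P) * ennreal (s powr (1 / P'))"
  proof -
    have "I \<le> epow (\<integral>\<^sup>+ x\<in>?B. epow (F x) P * ennreal (W x powr P) \<partial>lebesgue) (1 / P) * ennreal (s powr (1 / P'))"
      unfolding I_def s_def by (rule Holder_ball) (auto simp: r)
    also have "\<dots> \<le> epow J (1 / P) * ennreal (s powr (1 / P'))"
      unfolding J_def using P_pos by (intro mult_right_mono epow_mono nn_integral_mono) (auto simp: indicator_def)
    finally show ?thesis .
  qed
  then have "epow I ?e \<le> epow (epow J (1 / P) * ennreal (s powr (1 / P'))) ?e"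
    using e by (intro epow_mono) auto
  also have "\<dots> = epow J (?e / P) * ennreal (s powr (?e / P'))"
    using e pos by (simp add: epow_mult epow_epow epow_ennreal powr_powr)
  finally have I1: "epow I ?e \<le> epow J (?e / P) * ennreal (s powr (?e / P'))" .
  have I2: "I = a * ennreal s"
    using pos by (simp add: a_def ennreal_divide_times ennreal_times_divide mult_divide_eq_ennreal)
  have "I = epow I (P / Q) * epow I ?e"
    using epow_add[of "P / Q" ?e I] e P_pos Q_pos by simp
  also have "\<dots> \<le> (epow a (P / Q) * ennreal (s powr (P / Q))) * (epow J (?e / P) * ennreal (s powr (?e / P')))"
    using I1 pos P_pos Q_pos by (intro mult_mono) (auto simp: I2 epow_mult epow_ennreal)
  also have "\<dots> = epow J (?e / P) * (epow a (P / Q) * ennreal (s powr (P / Q) * s powr (?e / P')))"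
    by (simp add: ennreal_mult mult_ac)
  \<comment> \<open>The two powers of \<open>s\<close> recombine to the exponent \<open>d\<close>
    that \<open>pointwise_exponents\<close> expects.\<close>
  also have "s powr (P / Q) * s powr (?e / P') = s powr d"
  proof -
    have "P / Q + ?e / P' = d"
    proof -
      have "P / Q + ?e / P' = (P / Q) * (1 - 1 / P') + 1 / P'"
        by (simp add: algebra_simps diff_divide_distrib)
      also have "1 - 1 / P' = 1 / P" by (simp add: P'_eq)
      finally show ?thesis using P_pos by (simp add: d_def)
    qed
    then show ?thesis by (simp flip: powr_add)
  qed
  finally have I3: "I \<le> epow J (?e / P) * (epow a (P / Q) * ennreal (s powr d))" .
  have "I / epow (emeasure lebesgue ?B) d \<le> epow J (?e / P) * (epow a (P / Q) * ennreal (s powr d)) / ennreal (l powr d)"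
    using I3 pos by (simp add: em epow_ennreal divide_right_mono_ennreal)
  also have "\<dots> = epow J (?e / P) * (epow a (P / Q) * ennreal (s powr d / l powr d))"
    using pos by (simp add: divide_ennreal flip: ennreal_times_divide)
  also have "\<dots> \<le> epow J (?e / P) * (epow a (P / Q) * ennreal (A powr \<rho> * (l / v) powr ?\<theta>))"
    using pointwise_exponents[OF r, of c]
    by (intro mult_left_mono ennreal_leI) (auto simp: l_def s_def v_def)
  also have "\<dots> = ennreal (A powr \<rho>) * epow J (?e / P) * (epow a (P / Q) * ennreal ((l / v) powr ?\<theta>))"
    by (simp add: ennreal_mult mult_ac)
  also have "\<dots> \<le> ennreal (A powr \<rho>) * epow J (?e / P) * epow (maximal_fun V h x) ?\<theta>"
    by (intro mult_left_mono M) auto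
  finally show "(\<integral>\<^sup>+ y\<in>?B. F y \<partial>lebesgue) / epow (emeasure lebesgue ?B) d
    \<le> ennreal (A powr \<rho>) * epow J (?e / P) * epow (maximal_fun V h x) ?\<theta>"
    by (simp add: I_def)
qed

text \<open>The bound for \<open>maximal_fun V\<close> with exponent \<rho> is followed by the one
  for \<open>maximal_fun S\<close> with exponent \<open>P\<close>; the weights inside
  \<open>h\<close> and \<open>g\<close> make the integrals match. The pointwise estimate contributes
  \<open>J^(Q/P-1)\<close> and the two maximal operators contribute \<open>J\<close>, together
  \<open>J^(Q/P)\<close>.\<close>

theorem frac_maximal_fun_strong_type:
  obtains C :: real where "0 < C"
    "\<And>F. F \<in> borel_measurable lebesgue \<Longrightarrow>
      (\<integral>\<^sup>+ x. epow (frac_maximal_fun d F x) Q * ennreal (W x powr Q) \<partial>lebesgue) \<le>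
      ennreal C * epow (\<integral>\<^sup>+ x. epow (F x) P * ennreal (W x powr P) \<partial>lebesgue) (Q / P)"
proof -
  interpret V: doubling_measure V "dilation_const 6 powr Q" by (rule doubling_measure_V)
  interpret S: doubling_measure S "dilation_const 6 powr P'" by (rule doubling_measure_S)
  \<comment> \<open>\<open>C1\<close> and \<open>C2\<close> are the strong type constants of
    \<open>V\<close> at exponent \<rho> and of \<open>S\<close> at exponent \<open>P\<close>;
    \<open>C0\<close> is the \<open>Q\<close>-th power of the factor \<open>A powr \<rho>\<close> in
    the pointwise bound.\<close>
  define C1 where "C1 = \<rho> * 2 powr \<rho> * (dilation_const 6 powr Q) / (\<rho> - 1)"
  define C2 where "C2 = P * 2 powr P * (dilation_const 6 powr P') / (P - 1)"
  define C0 where "C0 = A powr (\<rho> * Q)"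
  have pos: "0 < C0" "0 < C1" "0 < C2"
    using A_pos \<rho>_gt_1 P_gt_1 dilation_const_pos[of 6] by (auto simp: C0_def C1_def C2_def)
  have "(\<integral>\<^sup>+ x. epow (frac_maximal_fun d F x) Q * ennreal (W x powr Q) \<partial>lebesgue) \<le>
      ennreal (C0 * C1 * C2) * epow (\<integral>\<^sup>+ x. epow (F x) P * ennreal (W x powr P) \<partial>lebesgue) (Q / P)"
    if [measurable]: "F \<in> borel_measurable lebesgue" for F
  proof -
    define J where "J = (\<integral>\<^sup>+ x. epow (F x) P * ennreal (W x powr P) \<partial>lebesgue)"
    define g where "g = (\<lambda>x. F x * ennreal (W x powr P'))"
    define h where "h = (\<lambda>x. epow (maximal_fun S g x) (P / \<rho>) * ennreal (W x powr - Q))"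
    let ?e = "(1 - P / Q) / P"
    have e: "0 \<le> ?e" "?e * Q = Q / P - 1" using P_less_Q Q_pos P_pos by (auto simp: field_simps)
    have [measurable]: "g \<in> borel_measurable lebesgue" "h \<in> borel_measurable lebesgue"
      unfolding g_def h_def by measurable
    have S1: "(\<integral>\<^sup>+ x. epow (g x) P \<partial>S) = J"
    proof -
      have "(\<integral>\<^sup>+ x. epow (g x) P \<partial>S) = (\<integral>\<^sup>+ x. epow (g x) P * ennreal (W x powr - P') \<partial>lebesgue)"
        by (rule nn_integral_S) measurable
      also have "\<dots> = J"
        unfolding J_def
      proof (intro nn_integral_cong)
        fix x
        have "W x powr (P' * P) * W x powr - P' = W x powr P"
          using P'P by (simp add: algebra_simps flip: powr_add)
        then show "epow (g x) P * ennreal (W x powr - P') = epow (F x) P * ennreal (W x powr P)"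
          using P_pos W_pos[of x] by (simp add: g_def epow_mult epow_ennreal powr_powr mult.assoc flip: ennreal_mult)
      qed
      finally show ?thesis .
    qed
    have "(\<integral>\<^sup>+ x. epow (maximal_fun V h x) \<rho> \<partial>V) \<le> ennreal C1 * (\<integral>\<^sup>+ x. epow (h x) \<rho> \<partial>V)"
      unfolding C1_def by (rule V.maximal_fun_strong_type) (auto simp: \<rho>_gt_1 measurable_VS)
    also have "(\<integral>\<^sup>+ x. epow (h x) \<rho> \<partial>V) = (\<integral>\<^sup>+ x. epow (maximal_fun S g x) P \<partial>S)"
    proof -
      have "(\<integral>\<^sup>+ x. epow (h x) \<rho> \<partial>V) = (\<integral>\<^sup>+ x. epow (h x) \<rho> * ennreal (W x powr Q) \<partial>lebesgue)"
        by (rule nn_integral_V) measurable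
      also have "\<dots> = (\<integral>\<^sup>+ x. epow (maximal_fun S g x) P * ennreal (W x powr - P') \<partial>lebesgue)"
      proof (intro nn_integral_cong)
        fix x
        have "- Q * \<rho> + Q = - P'" using Q_pos by (simp add: \<rho>_def field_simps)
        then have "W x powr (- Q * \<rho>) * W x powr Q = W x powr - P'"
          by (simp only: powr_add[symmetric])
        then show "epow (h x) \<rho> * ennreal (W x powr Q) = epow (maximal_fun S g x) P * ennreal (W x powr - P')"
          using \<rho>_gt_1 W_pos[of x]
          by (simp add: h_def epow_mult epow_epow epow_ennreal powr_powr mult.assoc flip: ennreal_mult)
      qed
      also have "\<dots> = (\<integral>\<^sup>+ x. epow (maximal_fun S g x) P \<partial>S)"
        by (rule nn_integral_S[symmetric]) measurable
      finally show ?thesis .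
    qed
    also have "\<dots> \<le> ennreal C2 * J"
      unfolding C2_def S1[symmetric] by (rule S.maximal_fun_strong_type) (auto simp: P_gt_1 measurable_VS)
    finally have M: "(\<integral>\<^sup>+ x. epow (maximal_fun V h x) \<rho> \<partial>V) \<le> ennreal C1 * (ennreal C2 * J)"
      by (simp add: mult_left_mono)
    have "(\<integral>\<^sup>+ x. epow (frac_maximal_fun d F x) Q * ennreal (W x powr Q) \<partial>lebesgue)
      \<le> (\<integral>\<^sup>+ x. ennreal C0 * epow J (Q / P - 1) * (epow (maximal_fun V h x) \<rho> * ennreal (W x powr Q)) \<partial>lebesgue)"
    proof (intro nn_integral_mono)
      fix x
      have "epow (frac_maximal_fun d F x) Q \<le>
          epow (ennreal (A powr \<rho>) * epow J ?e * epow (maximal_fun V h x) (\<rho> / Q)) Q"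
        unfolding J_def h_def g_def using Q_pos by (intro epow_mono frac_maximal_fun_pointwise) auto
      also have "\<dots> = ennreal C0 * epow J (Q / P - 1) * epow (maximal_fun V h x) \<rho>"
        using Q_pos A_pos by (simp only: e epow_mult epow_epow less_imp_le) (simp add: epow_ennreal powr_powr C0_def)
      finally show "epow (frac_maximal_fun d F x) Q * ennreal (W x powr Q) \<le>
          ennreal C0 * epow J (Q / P - 1) * (epow (maximal_fun V h x) \<rho> * ennreal (W x powr Q))"
        by (simp add: mult_right_mono mult.assoc[symmetric])
    qed
    also have "\<dots> = ennreal C0 * epow J (Q / P - 1) * (\<integral>\<^sup>+ x. epow (maximal_fun V h x) \<rho> \<partial>V)"
      by (subst nn_integral_cmult) (auto simp: nn_integral_V)
    also have "\<dots> \<le> ennreal C0 * epow J (Q / P - 1) * (ennreal C1 * (ennreal C2 * J))"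
      by (intro mult_left_mono M) auto
    also have "\<dots> = ennreal (C0 * C1 * C2) * (epow J (Q / P - 1) * epow J 1)"
      using pos by (simp add: ennreal_mult mult_ac)
    also have "epow J (Q / P - 1) * epow J 1 = epow J (Q / P)"
      using P_pos P_less_Q by (subst epow_add[symmetric]) auto
    finally show ?thesis by (simp add: J_def)
  qed
  then show ?thesis using pos by (intro that[of "C0 * C1 * C2"]) auto
qed

section \<open>Near and far parts, and the Morrey estimate for the fractional maximal
  operator\<close>

lemma frac_maximal_fun_split:
  assumes [measurable]: "F \<in> borel_measurable lebesgue" and x: "x \<in> ball c R"
    and E: "\<And>r. R < r \<Longrightarrow>
      (\<integral>\<^sup>+ y\<in>ball c (3 * r). F y \<partial>lebesgue) / epow (emeasure lebesgue (ball c r)) d \<le> E"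
  shows "frac_maximal_fun d F x \<le> frac_maximal_fun d (\<lambda>y. F y * indicator (ball c (3 * R)) y) x + E"
  unfolding frac_maximal_fun_def[of _ F]
proof (safe intro!: SUP_least)
  fix b r assume b: "x \<in> ball b r"
  let ?F = "\<lambda>y. F y * indicator (ball c (3 * R)) y"
  \<comment> \<open>Both balls contain \<open>x\<close>. The radius \<open>R + 2 * r\<close> is at
    most \<open>3 * R\<close> if \<open>r \<le> R\<close>, so small balls see only the near part,
    and it is less than \<open>3 * r\<close> if \<open>r > R\<close>, so large balls lie in one
    centred at \<open>c\<close>.\<close>
  have in_ball: "z \<in> ball c (R + 2 * r)" if "z \<in> ball b r" for z
  proof -
    have "dist c z \<le> dist c x + dist b x + dist b z"
      using dist_triangle[of c z x] dist_triangle[of x z b] by (simp add: dist_commute)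
    then show ?thesis using b x that by simp
  qed
  show "(\<integral>\<^sup>+ y\<in>ball b r. F y \<partial>lebesgue) / epow (emeasure lebesgue (ball b r)) d \<le> frac_maximal_fun d ?F x + E"
  proof (cases "r \<le> R")
    case True
    have "z \<in> ball c (3 * R)" if "z \<in> ball b r" for z
      using in_ball[OF that] True by simp
    then have "(\<integral>\<^sup>+ y\<in>ball b r. F y \<partial>lebesgue) = (\<integral>\<^sup>+ y\<in>ball b r. ?F y \<partial>lebesgue)"
      by (intro nn_integral_cong) (auto simp: indicator_def)
    then show ?thesis
      using frac_maximal_fun_upper[OF b, of ?F d] by (simp add: add_increasing2)
  next
    case False
    have r: "0 < r" using b zero_le_dist[of b x] by (simp del: zero_le_dist)
    have sub: "z \<in> ball c (3 * r)" if "z \<in> ball b r" for z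
      using in_ball[OF that] False by simp
    \<comment> \<open>Equal radii give equal volumes, so the normalising factor can be moved to the
      centre \<open>c\<close>.\<close>
    have eq: "emeasure lebesgue (ball b r) = emeasure lebesgue (ball c r)"
      using r by (simp add: emeasure_ball)
    have "(\<integral>\<^sup>+ y\<in>ball b r. F y \<partial>lebesgue) / epow (emeasure lebesgue (ball b r)) d \<le>
        (\<integral>\<^sup>+ y\<in>ball c (3 * r). F y \<partial>lebesgue) / epow (emeasure lebesgue (ball c r)) d"
      unfolding eq using sub
      by (intro divide_right_mono_ennreal nn_integral_mono mult_left_mono) (auto simp: indicator_def)
    also have "\<dots> \<le> E" using False by (intro E) auto
    finally show ?thesis by (simp add: add_increasing)
  qed
qed

text \<open>Hoelder's inequality on the ball of radius \<open>3 * r\<close>, the Morrey hypothesis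
  and the \<open>A(P,Q)\<close> bound leave the power \<open>\<kappa> / P - 1 / Q\<close> of its
  \<open>V\<close>-measure. This exponent is negative, so that measure may be replaced by the
  smaller one of the ball of radius \<open>R\<close>, and the bound becomes independent of
  \<open>r\<close>.\<close>

lemma far_average_le:
  assumes [measurable]: "F \<in> borel_measurable lebesgue" and r: "0 < R" "R < r"
    and \<kappa>: "\<kappa> < P / Q"
    and N: "(\<integral>\<^sup>+ x\<in>ball c (3 * r). epow (F x) P * ennreal (W x powr P) \<partial>lebesgue)
      \<le> epow N P * epow (emeasure V (ball c (3 * r))) \<kappa>"
  shows "(\<integral>\<^sup>+ y\<in>ball c (3 * r). F y \<partial>lebesgue) / epow (emeasure lebesgue (ball c r)) d
    \<le> N * ennreal (dilation_const 3 * measure V (ball c R) powr (\<kappa> / P - 1 / Q))"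
proof -
  let ?B = "ball c (3 * r)"
  have r': "0 < r" "0 < 3 * r" using r by auto
  let ?v = "measure V ?B" and ?s = "measure S ?B" and ?l = "leb c r"
  note em = emeasure_V_ball[OF r'(2), of c] emeasure_S_ball[OF r'(2), of c]
  note l = leb_pos[OF r'(1), of c]
  have "(\<integral>\<^sup>+ y\<in>?B. F y \<partial>lebesgue) \<le>
      epow (\<integral>\<^sup>+ x\<in>?B. epow (F x) P * ennreal (W x powr P) \<partial>lebesgue) (1 / P) * ennreal (?s powr (1 / P'))"
    by (rule Holder_ball) (auto simp: r')
  also have "\<dots> \<le> epow (epow N P * epow (emeasure V ?B) \<kappa>) (1 / P) * ennreal (?s powr (1 / P'))"
    using P_pos by (intro mult_right_mono epow_mono N) auto
  also have "\<dots> = N * (ennreal (?v powr (\<kappa> / P)) * ennreal (?s powr (1 / P')))"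
    using P_pos em by (simp add: epow_mult epow_epow epow_ennreal powr_powr mult.assoc)
  finally have "(\<integral>\<^sup>+ y\<in>?B. F y \<partial>lebesgue) / epow (emeasure lebesgue (ball c r)) d \<le>
     N * (ennreal (?v powr (\<kappa> / P)) * ennreal (?s powr (1 / P'))) / ennreal (?l powr d)"
    using l by (simp add: emeasure_leb[OF r'(1)] epow_ennreal divide_right_mono_ennreal)
  also have "\<dots> = N * ennreal (?v powr (\<kappa> / P) * ?s powr (1 / P') / ?l powr d)"
    using l by (simp add: divide_ennreal flip: ennreal_times_divide ennreal_mult)
  also have "\<dots> \<le> N * ennreal (dilation_const 3 * measure V (ball c R) powr (\<kappa> / P - 1 / Q))"
  proof (intro mult_left_mono ennreal_leI)
    have "?v powr (1 / Q) * ?s powr (1 / P') \<le> A * leb c (3 * r) powr d"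
      using r' by (intro Apq_real) auto
    also have "\<dots> = dilation_const 3 * ?l powr d"
      using r' by (subst measure_lebesgue_ball_scale) (auto simp: powr_mult dilation_const_def)
    finally have "?s powr (1 / P') / ?l powr d \<le> dilation_const 3 / ?v powr (1 / Q)"
      using em(2) l by (simp add: field_simps)
    then have "?v powr (\<kappa> / P) * (?s powr (1 / P') / ?l powr d) \<le> ?v powr (\<kappa> / P) * (dilation_const 3 / ?v powr (1 / Q))"
      by (rule mult_left_mono) simp
    also have "\<dots> = dilation_const 3 * ?v powr (\<kappa> / P - 1 / Q)"
      by (simp add: powr_diff)
    also have "\<dots> \<le> dilation_const 3 * measure V (ball c R) powr (\<kappa> / P - 1 / Q)"
    proof (intro mult_left_mono powr_mono2')
      show "\<kappa> / P - 1 / Q \<le> 0" using \<kappa> P_pos Q_pos by (simp add: field_simps)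
      show "measure V (ball c R) \<le> ?v" using r by (intro measure_mono_ball) auto
      show "0 < measure V (ball c R)" using r by (intro emeasure_V_ball)
    qed (use dilation_const_pos[of 3] in auto)
    finally show "?v powr (\<kappa> / P) * ?s powr (1 / P') / ?l powr d \<le> dilation_const 3 * measure V (ball c R) powr (\<kappa> / P - 1 / Q)"
      by simp
  qed simp
  finally show ?thesis .
qed

text \<open>The Morrey hypothesis enters as inequalities on balls with a free constant
  \<open>N\<close>, so that no supremum has to be handled. The near part lives on the threefold
  ball, whose \<open>V\<close>-measure is brought back to that of the ball by doubling.\<close>

theorem frac_maximal_fun_morrey:
  assumes \<kappa>: "0 < \<kappa>" "\<kappa> < P / Q"
  shows "\<exists>C::real. 0 < C \<and> (\<forall>F\<in>borel_measurable lebesgue. \<forall>N.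
      (\<forall>c r. 0 < r \<longrightarrow> (\<integral>\<^sup>+ x\<in>ball c r. epow (F x) P * ennreal (W x powr P) \<partial>lebesgue)
        \<le> epow N P * epow (emeasure V (ball c r)) \<kappa>) \<longrightarrow>
      (\<forall>c r. 0 < r \<longrightarrow>
        (\<integral>\<^sup>+ x\<in>ball c r. epow (frac_maximal_fun d F x) Q * ennreal (W x powr Q) \<partial>lebesgue)
        \<le> ennreal C * epow N Q * epow (emeasure V (ball c r)) (\<kappa> * Q / P)))"
proof -
  obtain C0 where C0: "0 < C0" "\<And>F. F \<in> borel_measurable lebesgue \<Longrightarrow>
      (\<integral>\<^sup>+ x. epow (frac_maximal_fun d F x) Q * ennreal (W x powr Q) \<partial>lebesgue) \<le>
      ennreal C0 * epow (\<integral>\<^sup>+ x. epow (F x) P * ennreal (W x powr P) \<partial>lebesgue) (Q / P)"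
    by (rule frac_maximal_fun_strong_type) blast
  \<comment> \<open>The factor \<open>2 powr Q\<close> pays for splitting the \<open>Q\<close>-th
    power of a sum. The first summand belongs to the near part, strong type times doubling by 3; the
    second belongs to the far part.\<close>
  define C where "C = 2 powr Q * (C0 * (dilation_const 3 powr Q) powr (\<kappa> * Q / P) + dilation_const 3 powr Q)"
  have "0 < C" using C0(1) dilation_const_pos[of 3] by (simp add: C_def add_pos_pos)
  moreover have "(\<integral>\<^sup>+ x\<in>ball c r. epow (frac_maximal_fun d F x) Q * ennreal (W x powr Q) \<partial>lebesgue) \<le>
      ennreal C * epow N Q * epow (emeasure V (ball c r)) (\<kappa> * Q / P)"
    if [measurable]: "F \<in> borel_measurable lebesgue"
      and N: "\<And>c r. 0 < r \<Longrightarrow> (\<integral>\<^sup>+ x\<in>ball c r. epow (F x) P * ennreal (W x powr P) \<partial>lebesgue)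
        \<le> epow N P * epow (emeasure V (ball c r)) \<kappa>" and r: "0 < r" for F N c r
  proof -
    let ?B = "ball c r"
    define v where "v = measure V ?B"
    have v: "0 < v" "emeasure V ?B = ennreal v" using emeasure_V_ball[OF r] by (auto simp: v_def)
    define F1 where "F1 = (\<lambda>y. F y * indicator (ball c (3 * r)) y)"
    have [measurable]: "F1 \<in> borel_measurable lebesgue" unfolding F1_def by measurable
    \<comment> \<open>\<open>E\<close> is the bound of \<open>far_average_le\<close>, uniform over
      the large radii; \<open>T\<close>, next, is the target up to a constant.\<close>
    define E where "E = N * ennreal (dilation_const 3 * v powr (\<kappa> / P - 1 / Q))"
    define T where "T = epow N Q * ennreal (v powr (\<kappa> * Q / P))"
    have "(\<integral>\<^sup>+ x\<in>?B. epow (frac_maximal_fun d F x) Q * ennreal (W x powr Q) \<partial>lebesgue)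
      \<le> (\<integral>\<^sup>+ x. ennreal (2 powr Q) * (epow (frac_maximal_fun d F1 x) Q * ennreal (W x powr Q)
          + epow E Q * (ennreal (W x powr Q) * indicator ?B x)) \<partial>lebesgue)"
    proof (intro nn_integral_mono)
      fix x
      show "epow (frac_maximal_fun d F x) Q * ennreal (W x powr Q) * indicator ?B x \<le>
         ennreal (2 powr Q) * (epow (frac_maximal_fun d F1 x) Q * ennreal (W x powr Q)
          + epow E Q * (ennreal (W x powr Q) * indicator ?B x))"
      proof (cases "x \<in> ?B")
        case True
        have "frac_maximal_fun d F x \<le> frac_maximal_fun d F1 x + E"
          unfolding F1_def E_def v_def
          using True r \<kappa> by (intro frac_maximal_fun_split far_average_le N) auto
        then have "epow (frac_maximal_fun d F x) Q \<le> epow (frac_maximal_fun d F1 x + E) Q"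
          using Q_pos by (intro epow_mono) auto
        also have "\<dots> \<le> ennreal (2 powr Q) * (epow (frac_maximal_fun d F1 x) Q + epow E Q)"
          by (rule epow_add_le[OF Q_pos])
        finally have "epow (frac_maximal_fun d F x) Q * ennreal (W x powr Q) \<le>
            ennreal (2 powr Q) * (epow (frac_maximal_fun d F1 x) Q + epow E Q) * ennreal (W x powr Q)"
          by (rule mult_right_mono) simp
        then show ?thesis using True by (simp add: algebra_simps)
      qed simp
    qed
    also have "\<dots> = ennreal (2 powr Q) * ((\<integral>\<^sup>+ x. epow (frac_maximal_fun d F1 x) Q * ennreal (W x powr Q) \<partial>lebesgue)
        + epow E Q * emeasure V ?B)"
      by (simp add: nn_integral_cmult nn_integral_add emeasure_V)
    also have "\<dots> \<le> ennreal (2 powr Q) * (ennreal (C0 * (dilation_const 3 powr Q) powr (\<kappa> * Q / P)) * T + ennreal (dilation_const 3 powr Q) * T)"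
    proof (intro mult_left_mono add_mono)
      have "(\<integral>\<^sup>+ x. epow (frac_maximal_fun d F1 x) Q * ennreal (W x powr Q) \<partial>lebesgue)
        \<le> ennreal C0 * epow (\<integral>\<^sup>+ x. epow (F1 x) P * ennreal (W x powr P) \<partial>lebesgue) (Q / P)"
        by (rule C0(2)) measurable
      also have "(\<integral>\<^sup>+ x. epow (F1 x) P * ennreal (W x powr P) \<partial>lebesgue) =
          (\<integral>\<^sup>+ x\<in>ball c (3 * r). epow (F x) P * ennreal (W x powr P) \<partial>lebesgue)"
        using P_pos by (intro nn_integral_cong) (auto simp: F1_def indicator_def)
      also have "ennreal C0 * epow \<dots> (Q / P) \<le>
          ennreal C0 * epow (epow N P * epow (ennreal (dilation_const 3 powr Q * v)) \<kappa>) (Q / P)"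
      proof (intro mult_left_mono epow_mono)
        have "emeasure V (ball c (3 * r)) \<le> ennreal (dilation_const 3 powr Q * v)"
          using doubling_V[OF r, of 3 c] r by (subst emeasure_V_ball) (auto simp: v_def)
        then have "epow (emeasure V (ball c (3 * r))) \<kappa> \<le> epow (ennreal (dilation_const 3 powr Q * v)) \<kappa>"
          using \<kappa> by (intro epow_mono) auto
        then show "(\<integral>\<^sup>+ x\<in>ball c (3 * r). epow (F x) P * ennreal (W x powr P) \<partial>lebesgue)
          \<le> epow N P * epow (ennreal (dilation_const 3 powr Q * v)) \<kappa>"
          using r by (intro order_trans[OF N] mult_left_mono) auto
      qed (use P_pos Q_pos in auto)
      also have "epow (epow N P * epow (ennreal (dilation_const 3 powr Q * v)) \<kappa>) (Q / P) =
          epow N Q * ennreal ((dilation_const 3 powr Q * v) powr (\<kappa> * Q / P))"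
      proof -
        have "0 < dilation_const 3 powr Q * v" using v(1) dilation_const_pos[of 3] by simp
        then show ?thesis
          using P_pos Q_pos by (simp add: epow_mult epow_epow) (simp add: epow_ennreal)
      qed
      also have "ennreal C0 * (epow N Q * ennreal ((dilation_const 3 powr Q * v) powr (\<kappa> * Q / P))) =
          ennreal (C0 * (dilation_const 3 powr Q) powr (\<kappa> * Q / P)) * T"
        using C0(1) v(1) by (simp add: T_def powr_mult ennreal_mult mult_ac)
      finally show "(\<integral>\<^sup>+ x. epow (frac_maximal_fun d F1 x) Q * ennreal (W x powr Q) \<partial>lebesgue)
        \<le> ennreal (C0 * (dilation_const 3 powr Q) powr (\<kappa> * Q / P)) * T" .
      have "epow E Q * emeasure V ?B = epow N Q * ennreal ((dilation_const 3 * v powr (\<kappa> / P - 1 / Q)) powr Q * v)"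
        using Q_pos dilation_const_pos[of 3] v by (simp add: E_def epow_mult epow_ennreal mult.assoc flip: ennreal_mult)
      also have "(dilation_const 3 * v powr (\<kappa> / P - 1 / Q)) powr Q * v = dilation_const 3 powr Q * (v powr ((\<kappa> / P - 1 / Q) * Q) * v powr 1)"
        using dilation_const_pos[of 3] v(1) by (simp add: powr_mult powr_powr)
      \<comment> \<open>Here \<open>(\<kappa> / P - 1 / Q) * Q + 1 = \<kappa> * Q / P\<close>:
        integrating the constant far bound over the ball gives exactly the target power.\<close>
      also have "v powr ((\<kappa> / P - 1 / Q) * Q) * v powr 1 = v powr (\<kappa> * Q / P)"
        using Q_pos by (subst powr_add[symmetric]) (simp add: algebra_simps)
      finally show "epow E Q * emeasure V ?B \<le> ennreal (dilation_const 3 powr Q) * T"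
        by (simp add: T_def ennreal_mult mult_ac)
    qed simp
    also have "\<dots> = ennreal C * T"
      using C0(1) by (simp add: C_def ennreal_mult ennreal_plus algebra_simps)
    also have "\<dots> = ennreal C * epow N Q * epow (emeasure V ?B) (\<kappa> * Q / P)"
      using v by (simp add: T_def epow_ennreal mult.assoc)
    finally show ?thesis .
  qed
  ultimately show ?thesis by (intro exI[of _ C]) simp
qed

end

section \<open>Rough kernels\<close>

lemma nn_integral_lborel_affine:
  fixes t :: "'a::euclidean_space"
  assumes [measurable]: "f \<in> borel_measurable borel" and c: "c \<noteq> 0"
  shows "(\<integral>\<^sup>+ x. f x \<partial>lborel) = ennreal (\<bar>c\<bar> ^ DIM('a)) * (\<integral>\<^sup>+ x. f (t + c *\<^sub>R x) \<partial>lborel)"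
  by (subst lborel_affine[OF c, of t])
    (simp add: nn_integral_density nn_integral_distr nn_integral_cmult)

lemma AE_lborel_affine:
  fixes t :: "'a::euclidean_space"
  assumes P: "AE x in lborel. P x" and c: "c \<noteq> 0"
  shows "AE x in lborel. P (t + c *\<^sub>R x)"
proof -
  have "AE x in density (distr lborel borel (\<lambda>x. t + c *\<^sub>R x)) (\<lambda>_. \<bar>c\<bar> ^ DIM('a)). P x"
    using P by (subst (asm) lborel_affine[OF c, of t])
  then have "AE x in distr lborel borel (\<lambda>x. t + c *\<^sub>R x). P x"
    using c by (subst (asm) AE_density) auto
  then show ?thesis by (rule AE_distrD[rotated]) simp
qed

text \<open>\<open>sphere_measure\<close> is an image of Lebesgue measure on the unit ball, so a
  null set of directions spans a null cone in that ball. Dilations preserve null sets and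
  directions, and countably many of them reach the whole space.\<close>

lemma AE_sphere_measureD:
  assumes "AE x in (sphere_measure :: 'a::euclidean_space measure). P x"
  shows "AE y in (lborel :: 'a measure). y \<noteq> 0 \<longrightarrow> P (sgn y)"
proof -
  let ?U = "uniform_measure lborel (ball 0 1) :: 'a measure"
  have "AE x in restrict_space (distr ?U borel sgn) (sphere 0 1). P x"
    using assms unfolding sphere_measure_def AE_completion_iff .
  then have "AE x in distr ?U borel sgn. x \<in> sphere 0 1 \<longrightarrow> P x"
    by (subst (asm) AE_restrict_space_iff) auto
  then have "AE y in ?U. sgn y \<in> sphere 0 1 \<longrightarrow> P (sgn y)"
    by (rule AE_distrD[rotated]) simp
  moreover have "emeasure lborel (ball (0::'a) 1) \<noteq> 0" "emeasure lborel (ball (0::'a) 1) < \<infinity>"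
    by (auto simp: emeasure_ball unit_ball_vol_pos less_imp_neq[symmetric])
  ultimately have ball: "AE y in lborel. y \<in> ball (0::'a) 1 \<longrightarrow> sgn y \<in> sphere 0 1 \<longrightarrow> P (sgn y)"
    by (simp add: AE_uniform_measure)
  \<comment> \<open>Dilation by \<open>1 / Suc n\<close> brings \<open>y\<close> into the unit ball
    as soon as \<open>norm y < n\<close>.\<close>
  have "AE y in lborel. \<forall>n::nat. 0 + (1 / real (Suc n)) *\<^sub>R y \<in> ball (0::'a) 1 \<longrightarrow>
      sgn (0 + (1 / real (Suc n)) *\<^sub>R y) \<in> sphere 0 1 \<longrightarrow> P (sgn (0 + (1 / real (Suc n)) *\<^sub>R y))"
    unfolding AE_all_countable by (intro allI AE_lborel_affine[OF ball]) simp
  then show ?thesis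
  proof eventually_elim
    case (elim y)
    obtain n where n: "norm y < real n" using reals_Archimedean2 by blast
    have *: "sgn (0 + (1 / real (Suc n)) *\<^sub>R y) = sgn y"
      by (simp add: sgn_scaleR)
    have "0 + (1 / real (Suc n)) *\<^sub>R y \<in> ball 0 1"
      using n by (simp add: field_simps)
    with elim[rule_format, of n] show ?case unfolding * by (auto simp: norm_sgn)
  qed
qed

text \<open>Members of \<open>Ls_sphere\<close> are measurable only for a completed measure. A Borel
  version extended by 0 can be composed with \<open>sgn\<close> and integrated over the whole
  space.\<close>

lemma sphere_measure_borel_representative:
  fixes g :: "'a::euclidean_space \<Rightarrow> ennreal"
  assumes "g \<in> borel_measurable sphere_measure"
  obtains G where "G \<in> borel_measurable borel" "AE x in sphere_measure. g x = G x"
    "\<And>x. x \<notin> sphere 0 1 \<Longrightarrow> G x = 0"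
proof -
  let ?D = "distr (uniform_measure lborel (ball 0 1)) borel sgn :: 'a measure"
  let ?R = "restrict_space ?D (sphere 0 1)"
  obtain g' where g': "g' \<in> borel_measurable ?R" "AE x in ?R. g x = g' x"
    using completion_ex_borel_measurable assms unfolding sphere_measure_def by blast
  have sp: "sphere 0 1 \<inter> space ?D \<in> sets ?D" by simp
  show ?thesis
  proof
    show "(\<lambda>x. g' x * indicator (sphere 0 1) x) \<in> borel_measurable borel"
      using g'(1) by (subst (asm) borel_measurable_restrict_space_iff_ennreal[OF sp]) simp
    have "AE x in ?R. g x = g' x * indicator (sphere 0 1) x"
      using g'(2) unfolding AE_restrict_space_iff[OF sp] by eventually_elim auto
    then show "AE x in sphere_measure. g x = g' x * indicator (sphere 0 1) x"
      unfolding sphere_measure_def AE_completion_iff .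
  qed simp
qed

lemma nn_integral_sphere_measure:
  fixes G :: "'a::euclidean_space \<Rightarrow> ennreal"
  assumes [measurable]: "G \<in> borel_measurable borel" and G: "\<And>x. x \<notin> sphere 0 1 \<Longrightarrow> G x = 0"
  shows "(\<integral>\<^sup>+ x. G x \<partial>sphere_measure) = (\<integral>\<^sup>+ y\<in>ball 0 1. G (sgn y) \<partial>lborel) / emeasure lborel (ball (0::'a) 1)"
proof -
  have "(\<integral>\<^sup>+ x. G x \<partial>sphere_measure) =
      (\<integral>\<^sup>+ x. G x * indicator (sphere 0 1) x \<partial>distr (uniform_measure lborel (ball (0::'a) 1)) borel sgn)"
    by (simp add: sphere_measure_def nn_integral_completion nn_integral_restrict_space)
  also have "\<dots> = (\<integral>\<^sup>+ x. G x \<partial>distr (uniform_measure lborel (ball (0::'a) 1)) borel sgn)"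
    using G by (intro nn_integral_cong) (auto simp: indicator_def)
  also have "\<dots> = (\<integral>\<^sup>+ y\<in>ball 0 1. G (sgn y) \<partial>lborel) / emeasure lborel (ball (0::'a) 1)"
    by (simp add: nn_integral_distr nn_integral_uniform_measure)
  finally show ?thesis .
qed

text \<open>Positive dilations leave \<open>sgn\<close> unchanged, so only the Jacobian appears. The
  factor 2 comes from enlarging the closed ball to an open one that rescales to
  \<open>ball 0 1\<close>.\<close>

lemma nn_integral_homogeneous_cball_le:
  fixes H :: "'a::euclidean_space \<Rightarrow> ennreal"
  assumes [measurable]: "H \<in> borel_measurable borel" and r: "0 < r"
  shows "(\<integral>\<^sup>+ y\<in>cball 0 r. H (sgn y) \<partial>lborel) \<le>
    ennreal ((2 * r) ^ DIM('a)) * (\<integral>\<^sup>+ y\<in>ball 0 1. H (sgn y) \<partial>lborel)"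
proof -
  have "(\<integral>\<^sup>+ y\<in>cball 0 r. H (sgn y) \<partial>lborel) \<le> (\<integral>\<^sup>+ y\<in>ball 0 (2 * r). H (sgn y) \<partial>lborel)"
    using r by (intro nn_integral_mono) (auto simp: indicator_def)
  also have "\<dots> = ennreal (\<bar>2 * r\<bar> ^ DIM('a)) *
      (\<integral>\<^sup>+ y. H (sgn (0 + (2 * r) *\<^sub>R y)) * indicator (ball 0 (2 * r)) (0 + (2 * r) *\<^sub>R y) \<partial>lborel)"
    using r by (intro nn_integral_lborel_affine) auto
  also have "(\<integral>\<^sup>+ y. H (sgn (0 + (2 * r) *\<^sub>R y)) * indicator (ball 0 (2 * r)) (0 + (2 * r) *\<^sub>R y) \<partial>lborel) =
      (\<integral>\<^sup>+ y\<in>ball 0 1. H (sgn y) \<partial>lborel)"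
    using r by (intro nn_integral_cong) (auto simp: indicator_def sgn_scaleR)
  finally show ?thesis using r by simp
qed

lemma conj_exp_ereal: "conj_exp (ereal x) = x / (x - 1)"
  by (simp add: conj_exp_def)

text \<open>Hoelder's inequality on a ball with exponents \<open>s\<close> and \<open>t\<close>, for
  a Borel version of the kernel. The \<open>L^s\<close> norm of a function of the direction over a
  ball of radius \<open>r\<close> grows like \<open>r^(n/s)\<close>, and
  \<open>n/s = n (1 - 1/t)\<close>. For \<open>s = \<infinity>\<close> this is the essential bound
  with \<open>t = 1\<close>.\<close>

lemma Ls_sphere_kernel:
  fixes \<Omega> :: "'a::euclidean_space \<Rightarrow> complex"
  assumes \<Omega>: "\<Omega> \<in> Ls_sphere s" and s: "1 < s"
  defines "t \<equiv> conj_exp s"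
  obtains G :: "'a \<Rightarrow> ennreal" and L :: real
  where "G \<in> borel_measurable borel" "AE y in lborel. ennreal (norm (\<Omega> (sgn y))) = G y" "0 \<le> L"
    "\<And>\<Phi> r. \<Phi> \<in> borel_measurable borel \<Longrightarrow> 0 < r \<Longrightarrow>
      (\<integral>\<^sup>+ y\<in>cball 0 r. (G y * \<Phi> y) \<partial>lborel) \<le>
      ennreal (L * r powr (DIM('a) * (1 - 1 / t))) * epow (\<integral>\<^sup>+ y\<in>cball 0 r. epow (\<Phi> y) t \<partial>lborel) (1 / t)"
proof -
  have meas: "(\<lambda>x. ennreal (norm (\<Omega> x))) \<in> borel_measurable sphere_measure"
    using \<Omega> by (auto simp: Ls_sphere_def)
  obtain H where H [measurable]: "H \<in> borel_measurable borel"
    and H_AE: "AE x in sphere_measure. ennreal (norm (\<Omega> x)) = H x"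
    and H0: "\<And>x. x \<notin> sphere 0 1 \<Longrightarrow> H x = 0"
    by (rule sphere_measure_borel_representative[OF meas]) blast
  define G where "G = (\<lambda>y. H (sgn y))"
  have G [measurable]: "G \<in> borel_measurable borel" by (simp add: G_def)
  have ne0: "AE y in (lborel :: 'a measure). y \<noteq> 0" by (rule AE_lborel_singleton)
  have G_AE: "AE y in lborel. ennreal (norm (\<Omega> (sgn y))) = G y"
    using AE_sphere_measureD[OF H_AE] ne0 by eventually_elim (simp add: G_def)
  show ?thesis
  proof (cases "s = \<infinity>")
    case True
    then have t: "t = 1" by (simp add: t_def conj_exp_def)
    have fin: "esssup sphere_measure (\<lambda>x. ennreal (norm (\<Omega> x))) < \<infinity>"
      using \<Omega> True by (auto simp: Ls_sphere_def)
    then obtain L where L: "0 \<le> L" "esssup sphere_measure (\<lambda>x. ennreal (norm (\<Omega> x))) = ennreal L"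
      by (cases "esssup sphere_measure (\<lambda>x. ennreal (norm (\<Omega> x)))") auto
    have "AE x in sphere_measure. ennreal (norm (\<Omega> x)) \<le> ennreal L"
      using esssup_AE[of "\<lambda>x. ennreal (norm (\<Omega> x))" sphere_measure] L by simp
    from AE_sphere_measureD[OF this] G_AE ne0 have "AE y in lborel. G y \<le> ennreal L"
      by eventually_elim auto
    then have "(\<integral>\<^sup>+ y\<in>cball 0 r. (G y * \<Phi> y) \<partial>lborel) \<le>
        ennreal (L * r powr (DIM('a) * (1 - 1 / t))) * epow (\<integral>\<^sup>+ y\<in>cball 0 r. epow (\<Phi> y) t \<partial>lborel) (1 / t)"
      if [measurable]: "\<Phi> \<in> borel_measurable borel" and r: "0 < r" for \<Phi> r
    proof -
      have "(\<integral>\<^sup>+ y\<in>cball 0 r. (G y * \<Phi> y) \<partial>lborel) \<le> (\<integral>\<^sup>+ y. ennreal L * (\<Phi> y * indicator (cball 0 r) y) \<partial>lborel)"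
        using \<open>AE y in lborel. G y \<le> ennreal L\<close>
        by (intro nn_integral_mono_AE) (auto elim!: eventually_mono simp: mult.assoc[symmetric] mult_right_mono)
      then show ?thesis using r by (simp add: t nn_integral_cmult)
    qed
    with G G_AE L(1) show ?thesis by (rule that)
  next
    case False
    with s obtain S where S: "s = ereal S" "1 < S" by (cases s) auto
    have t: "1 / t = 1 - 1 / S" "1 < t"
      using S by (auto simp: t_def conj_exp_ereal field_simps)
    have "(\<integral>\<^sup>+ x. ennreal (norm (\<Omega> x) powr S) \<partial>sphere_measure) < \<infinity>"
      using \<Omega> S by (auto simp: Ls_sphere_def)
    also have "(\<integral>\<^sup>+ x. ennreal (norm (\<Omega> x) powr S) \<partial>sphere_measure) = (\<integral>\<^sup>+ x. epow (H x) S \<partial>sphere_measure)"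
      using H_AE S(2) by (intro nn_integral_cong_AE) (auto elim!: eventually_mono simp flip: epow_ennreal_nonneg)
    also have "\<dots> = (\<integral>\<^sup>+ y\<in>ball 0 1. epow (H (sgn y)) S \<partial>lborel) / emeasure lborel (ball (0::'a) 1)"
      using H0 S(2) by (intro nn_integral_sphere_measure) auto
    finally have "(\<integral>\<^sup>+ y\<in>ball 0 1. epow (H (sgn y)) S \<partial>lborel) < \<infinity>"
      by (auto simp: emeasure_ball less_top[symmetric] ennreal_divide_eq_top_iff)
    then obtain M where M: "0 \<le> M" "(\<integral>\<^sup>+ y\<in>ball 0 1. epow (H (sgn y)) S \<partial>lborel) = ennreal M"
      by (cases "\<integral>\<^sup>+ y\<in>ball 0 1. epow (H (sgn y)) S \<partial>lborel") auto
    \<comment> \<open>The integral of \<open>epow (G y) S\<close> over \<open>cball 0 r\<close> is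
      at most \<open>2^n * M * r^n\<close>; \<open>L\<close> is the \<open>S\<close>-th root of the
      constant.\<close>
    define L where "L = (2 ^ DIM('a) * M) powr (1 / S)"
    have "(\<integral>\<^sup>+ y\<in>cball 0 r. (G y * \<Phi> y) \<partial>lborel) \<le>
        ennreal (L * r powr (DIM('a) * (1 - 1 / t))) * epow (\<integral>\<^sup>+ y\<in>cball 0 r. epow (\<Phi> y) t \<partial>lborel) (1 / t)"
      if [measurable]: "\<Phi> \<in> borel_measurable borel" and r: "0 < r" for \<Phi> r
    proof -
      have "(\<integral>\<^sup>+ y\<in>cball 0 r. (G y * \<Phi> y) \<partial>lborel) =
          (\<integral>\<^sup>+ y\<in>cball 0 r. (epow (epow (G y) S) (1 / S) * epow (epow (\<Phi> y) t) (1 / t)) \<partial>lborel)"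
        using S t(2) by (simp add: epow_epow)
      also have "\<dots> \<le> epow (\<integral>\<^sup>+ y\<in>cball 0 r. epow (G y) S \<partial>lborel) (1 / S) *
          epow (\<integral>\<^sup>+ y\<in>cball 0 r. epow (\<Phi> y) t \<partial>lborel) (1 / t)"
        using S t by (intro nn_integral_Holder_set) auto
      also have "\<dots> \<le> ennreal (L * r powr (DIM('a) * (1 - 1 / t))) * epow (\<integral>\<^sup>+ y\<in>cball 0 r. epow (\<Phi> y) t \<partial>lborel) (1 / t)"
      proof (rule mult_right_mono)
        have "(\<integral>\<^sup>+ y\<in>cball 0 r. epow (G y) S \<partial>lborel) \<le> ennreal ((2 * r) ^ DIM('a)) * ennreal M"
          unfolding M(2)[symmetric] G_def
          by (rule nn_integral_homogeneous_cball_le[where H="\<lambda>x. epow (H x) S"]) (auto simp: r)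
        also have "\<dots> = ennreal (2 ^ DIM('a) * M * r powr DIM('a))"
          using r M by (simp add: power_mult_distrib powr_realpow mult_ac flip: ennreal_mult)
        finally have "epow (\<integral>\<^sup>+ y\<in>cball 0 r. epow (G y) S \<partial>lborel) (1 / S) \<le> epow \<dots> (1 / S)"
          using S by (intro epow_mono) auto
        also have "\<dots> = ennreal (L * r powr (DIM('a) * (1 - 1 / t)))"
          using S M r t by (simp add: epow_ennreal_nonneg L_def powr_mult powr_powr)
        finally show "epow (\<integral>\<^sup>+ y\<in>cball 0 r. epow (G y) S \<partial>lborel) (1 / S) \<le> \<dots>" .
      qed simp
      finally show ?thesis .
    qed
    moreover have "0 \<le> L" by (simp add: L_def)
    ultimately show ?thesis using G G_AE by (intro that)
  qed
qed

section \<open>Measurability through rational radii, and comparison with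
  \<open>frac_maximal_fun\<close>\<close>

lemma SUP_pos_eq_SUP_rat:
  fixes H :: "real \<Rightarrow> ennreal"
  assumes mono: "\<And>r r'. 0 < r \<Longrightarrow> r \<le> r' \<Longrightarrow> H r \<le> H r'"
  shows "(SUP r\<in>{0<..}. ennreal (1 / r powr e) * H r) = (SUP r\<in>{0<..} \<inter> \<rat>. ennreal (1 / r powr e) * H r)"
proof (rule antisym)
  show "(SUP r\<in>{0<..}. ennreal (1 / r powr e) * H r) \<le> (SUP r\<in>{0<..} \<inter> \<rat>. ennreal (1 / r powr e) * H r)"
  proof (rule SUP_least, rule dense_le)
    fix r a assume r: "r \<in> {0::real<..}" and a: "a < ennreal (1 / r powr e) * H r"
    \<comment> \<open>\<open>H\<close> may jump, so it is frozen at \<open>r\<close> while the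
      continuous factor moves to a slightly larger rational radius; monotonicity then replaces
      \<open>H r\<close> by \<open>H \<rho>\<close>.\<close>
    have "((\<lambda>\<rho>. ennreal (1 / \<rho> powr e) * H r) \<longlongrightarrow> ennreal (1 / r powr e) * H r) (at_right r)"
    proof (rule tendsto_mult_ennreal)
      show "((\<lambda>\<rho>. ennreal (1 / \<rho> powr e)) \<longlongrightarrow> ennreal (1 / r powr e)) (at_right r)"
        using r by (intro tendsto_intros) auto
    qed (use r in auto)
    from order_tendstoD(1)[OF this a] obtain b where b: "r < b"
      "\<And>\<rho>. r < \<rho> \<Longrightarrow> \<rho> < b \<Longrightarrow> a < ennreal (1 / \<rho> powr e) * H r"
      by (auto simp: eventually_at_right_field)
    obtain \<rho> where \<rho>: "\<rho> \<in> \<rat>" "r < \<rho>" "\<rho> < b"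
      using Rats_dense_in_real[OF b(1)] by auto
    have "a \<le> ennreal (1 / \<rho> powr e) * H r" using b(2) \<rho> by (intro less_imp_le) auto
    also have "\<dots> \<le> ennreal (1 / \<rho> powr e) * H \<rho>" using \<rho> r by (intro mult_left_mono mono) auto
    also have "\<dots> \<le> (SUP r\<in>{0<..} \<inter> \<rat>. ennreal (1 / r powr e) * H r)"
      using \<rho> r by (intro SUP_upper) auto
    finally show "a \<le> (SUP r\<in>{0<..} \<inter> \<rat>. ennreal (1 / r powr e) * H r)" .
  qed
qed (intro SUP_subset_mono, auto)

text \<open>Null sets are preserved by \<open>y \<mapsto> x - y\<close>, so Borel representatives
  may be used at every point \<open>x\<close>, not only almost everywhere. The integrand then
  becomes jointly Borel in \<open>x\<close> and \<open>y\<close>, as the measurability of the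
  integral in \<open>x\<close> requires.\<close>

lemma frac_max_borel:
  fixes f :: "'a::euclidean_space \<Rightarrow> complex" and G \<Phi> :: "'a \<Rightarrow> ennreal"
  assumes G: "AE y in lborel. ennreal (norm (\<Omega> (sgn y))) = G y"
    and \<Phi>: "AE y in lborel. modulus f y = \<Phi> y"
  shows "frac_max \<Omega> \<alpha> f x = (SUP r\<in>{0<..}. ennreal (1 / r powr (real DIM('a) - \<alpha>))
       * (\<integral>\<^sup>+ y\<in>cball 0 r. (G y * \<Phi> (x - y)) \<partial>lborel))"
  unfolding frac_max_def
proof (intro SUP_cong refl arg_cong2[where f="(*)"])
  fix r :: real
  have "AE y in lborel. modulus f (x + (- 1) *\<^sub>R y) = \<Phi> (x + (- 1) *\<^sub>R y)"
    by (rule AE_lborel_affine[OF \<Phi>]) simp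
  with G have "AE y in lborel. ennreal (norm (\<Omega> (sgn y) * f (x - y))) = G y * \<Phi> (x - y)"
    by eventually_elim (simp add: modulus_def norm_mult ennreal_mult)
  then show "(\<integral>\<^sup>+ y\<in>cball 0 r. ennreal (norm (\<Omega> (sgn y) * f (x - y))) \<partial>lebesgue) =
      (\<integral>\<^sup>+ y\<in>cball 0 r. (G y * \<Phi> (x - y)) \<partial>lborel)"
    unfolding nn_integral_completion by (intro nn_integral_cong_AE) (auto elim!: eventually_mono)
qed

lemma borel_measurable_frac_max:
  fixes G \<Phi> :: "'a::euclidean_space \<Rightarrow> ennreal"
  assumes [measurable]: "G \<in> borel_measurable borel" "\<Phi> \<in> borel_measurable borel"
  shows "(\<lambda>x. SUP r\<in>{0<..}. ennreal (1 / r powr e)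
       * (\<integral>\<^sup>+ y\<in>cball 0 r. (G y * \<Phi> (x - y)) \<partial>lborel)) \<in> borel_measurable borel"
proof -
  have [measurable]: "(\<lambda>x. \<integral>\<^sup>+ y\<in>cball 0 r. (G y * \<Phi> (x - y)) \<partial>lborel) \<in> borel_measurable borel" for r
    by (rule lborel.borel_measurable_nn_integral) measurable
  have "countable ({0<..} \<inter> \<rat> :: real set)"
    by (rule countable_subset[OF _ countable_rat]) auto
  then have "(\<lambda>x. SUP r\<in>{0<..} \<inter> \<rat>. ennreal (1 / r powr e)
       * (\<integral>\<^sup>+ y\<in>cball 0 r. (G y * \<Phi> (x - y)) \<partial>lborel)) \<in> borel_measurable borel"
    by (intro borel_measurable_SUP) auto
  then show ?thesis
    by (subst SUP_pos_eq_SUP_rat) (auto intro!: nn_integral_mono simp: indicator_def)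
qed

text \<open>The kernel estimate, applied to the reflected translate of the modulus of
  \<open>f\<close>, leaves the integral of its \<open>t\<close>-th power over a ball about
  \<open>x\<close>. The hypothesis \<open>dn\<close> makes the powers of \<open>r\<close> cancel:
  \<open>n (1 - 1/t) + n d / t = n - \<alpha>\<close>.\<close>

lemma frac_max_le_frac_maximal_fun:
  fixes \<Omega> :: "'a::euclidean_space \<Rightarrow> complex" and d \<alpha> :: real
  assumes \<Omega>: "\<Omega> \<in> Ls_sphere s" and s: "1 < s" and t1: "1 \<le> conj_exp s"
    and dn: "d * real DIM('a) = real DIM('a) - \<alpha> * conj_exp s"
  obtains C :: real where "0 < C"
    "\<And>f. f \<in> borel_measurable lebesgue \<Longrightarrow> frac_max \<Omega> \<alpha> f \<in> borel_measurable lebesgue"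
    "\<And>f x. f \<in> borel_measurable lebesgue \<Longrightarrow> frac_max \<Omega> \<alpha> f x \<le>
      ennreal C * epow (frac_maximal_fun d (\<lambda>y. epow (modulus f y) (conj_exp s)) x) (1 / conj_exp s)"
proof -
  define t where "t = conj_exp s"
  have t: "1 \<le> t" using t1 by (simp add: t_def)
  obtain G :: "'a \<Rightarrow> ennreal" and L :: real where
    G [measurable]: "G \<in> borel_measurable borel" and G_AE: "AE y in lborel. ennreal (norm (\<Omega> (sgn y))) = G y"
    and L: "0 \<le> L" and G_le: "\<And>\<Phi> r. \<Phi> \<in> borel_measurable borel \<Longrightarrow> 0 < r \<Longrightarrow>
      (\<integral>\<^sup>+ y\<in>cball 0 r. (G y * \<Phi> y) \<partial>lborel) \<le>
      ennreal (L * r powr (DIM('a) * (1 - 1 / t))) * epow (\<integral>\<^sup>+ y\<in>cball 0 r. epow (\<Phi> y) t \<partial>lborel) (1 / t)"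
    unfolding t_def by (rule Ls_sphere_kernel[OF \<Omega> s]) blast
  \<comment> \<open>Closed balls of radius \<open>r\<close> will be enlarged to open ones of radius
    \<open>2 * r\<close>, whose volume is \<open>u * r^n\<close>.\<close>
  define u where "u = measure lebesgue (ball (0::'a) 2)"
  have u: "0 < u" by (simp add: u_def content_ball_pos)
  \<comment> \<open>The summand 1 keeps \<open>C\<close> positive when \<open>L = 0\<close>.\<close>
  define C where "C = L * u powr (d / t) + 1"
  have rep: "\<exists>\<Phi>\<in>borel_measurable borel. AE y in lborel. modulus f y = \<Phi> y"
    if "f \<in> borel_measurable lebesgue" for f :: "'a \<Rightarrow> complex"
    using completion_ex_borel_measurable[of "modulus f" lborel] that unfolding modulus_def by simp
  show ?thesis
  proof
    show "0 < C" using L by (simp add: C_def add_nonneg_pos)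
    show "frac_max \<Omega> \<alpha> f \<in> borel_measurable lebesgue" if f: "f \<in> borel_measurable lebesgue" for f
    proof -
      obtain \<Phi> where [measurable]: "\<Phi> \<in> borel_measurable borel" and \<Phi>: "AE y in lborel. modulus f y = \<Phi> y"
        using rep[OF f] by blast
      have "frac_max \<Omega> \<alpha> f \<in> borel_measurable borel"
        unfolding frac_max_borel[OF G_AE \<Phi>, abs_def] by (rule borel_measurable_frac_max) measurable
      then show ?thesis by (intro measurable_completion) simp
    qed
    show "frac_max \<Omega> \<alpha> f x \<le>
      ennreal C * epow (frac_maximal_fun d (\<lambda>y. epow (modulus f y) (conj_exp s)) x) (1 / conj_exp s)"
      if f: "f \<in> borel_measurable lebesgue" for f x
    proof -
      obtain \<Phi> where [measurable]: "\<Phi> \<in> borel_measurable borel" and \<Phi>: "AE y in lborel. modulus f y = \<Phi> y"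
        using rep[OF f] by blast
      let ?M = "frac_maximal_fun d (\<lambda>y. epow (modulus f y) t) x"
      show ?thesis
        unfolding frac_max_borel[OF G_AE \<Phi>] t_def[symmetric]
      proof (rule SUP_least)
        fix r :: real assume "r \<in> {0<..}"
        then have r: "0 < r" by simp
        let ?I = "\<integral>\<^sup>+ y\<in>ball x (2 * r). epow (modulus f y) t \<partial>lebesgue"
        have l: "measure lebesgue (ball x (2 * r)) = u * r powr DIM('a)"
          using r by (simp add: u_def content_ball powr_realpow power_mult_distrib)
        have em: "emeasure lebesgue (ball x (2 * r)) = ennreal (u * r powr DIM('a))"
          unfolding l[symmetric] by (rule emeasure_eq_ennreal_measure) (use r in \<open>simp add: emeasure_ball\<close>)
        have "(\<integral>\<^sup>+ y\<in>cball 0 r. epow (\<Phi> (x - y)) t \<partial>lborel) =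
            (\<integral>\<^sup>+ y. epow (\<Phi> (x + (- 1) *\<^sub>R y)) t * indicator (cball x r) (x + (- 1) *\<^sub>R y) \<partial>lborel)"
          by (intro nn_integral_cong) (auto simp: indicator_def dist_norm)
        also have "\<dots> = (\<integral>\<^sup>+ y\<in>cball x r. epow (\<Phi> y) t \<partial>lborel)"
          by (subst nn_integral_lborel_affine[where t=x and c="-1"]) auto
        also have "\<dots> = (\<integral>\<^sup>+ y\<in>cball x r. epow (modulus f y) t \<partial>lebesgue)"
          unfolding nn_integral_completion
          using \<Phi> by (intro nn_integral_cong_AE) (auto elim!: eventually_mono)
        also have "\<dots> \<le> ?I"
          using r by (intro nn_integral_mono) (auto simp: indicator_def)
        also have "\<dots> \<le> ?M * ennreal ((u * r powr DIM('a)) powr d)"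
        proof -
          have "?I / ennreal ((u * r powr DIM('a)) powr d) \<le> ?M"
            using frac_maximal_fun_upper[of x x "2 * r" "\<lambda>y. epow (modulus f y) t" d] r u
            by (simp add: em epow_ennreal)
          then have "?I / ennreal ((u * r powr DIM('a)) powr d) * ennreal ((u * r powr DIM('a)) powr d) \<le>
              ?M * ennreal ((u * r powr DIM('a)) powr d)"
            by (rule mult_right_mono) simp
          then show ?thesis
            using r u by (simp add: ennreal_divide_times mult_divide_eq_ennreal ennreal_times_divide)
        qed
        finally have I: "(\<integral>\<^sup>+ y\<in>cball 0 r. epow (\<Phi> (x - y)) t \<partial>lborel) \<le> ?M * ennreal ((u * r powr DIM('a)) powr d)" .
        have "(\<integral>\<^sup>+ y\<in>cball 0 r. (G y * \<Phi> (x - y)) \<partial>lborel) \<le>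
          ennreal (L * r powr (DIM('a) * (1 - 1 / t))) * epow (\<integral>\<^sup>+ y\<in>cball 0 r. epow (\<Phi> (x - y)) t \<partial>lborel) (1 / t)"
          using r by (intro G_le) auto
        also have "\<dots> \<le> ennreal (L * r powr (DIM('a) * (1 - 1 / t))) * epow (?M * ennreal ((u * r powr DIM('a)) powr d)) (1 / t)"
          using t by (intro mult_left_mono epow_mono I) auto
        also have "\<dots> = ennreal (L * r powr (DIM('a) * (1 - 1 / t))) *
            (epow ?M (1 / t) * ennreal (u powr (d / t) * r powr (DIM('a) * d / t)))"
          using t u r by (simp add: epow_mult epow_ennreal powr_mult powr_powr)
        finally have "ennreal (1 / r powr (real DIM('a) - \<alpha>)) * (\<integral>\<^sup>+ y\<in>cball 0 r. (G y * \<Phi> (x - y)) \<partial>lborel) \<le>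
            ennreal (1 / r powr (real DIM('a) - \<alpha>)) * (ennreal (L * r powr (DIM('a) * (1 - 1 / t))) *
            (epow ?M (1 / t) * ennreal (u powr (d / t) * r powr (DIM('a) * d / t))))"
          by (rule mult_left_mono) simp
        also have "\<dots> = ennreal (1 / r powr (real DIM('a) - \<alpha>) * (L * r powr (DIM('a) * (1 - 1 / t))) *
            (u powr (d / t) * r powr (DIM('a) * d / t))) * epow ?M (1 / t)"
          using L by (simp add: ennreal_mult mult_ac del: times_divide_eq_left times_divide_eq_right)
        also have "1 / r powr (real DIM('a) - \<alpha>) * (L * r powr (DIM('a) * (1 - 1 / t))) *
            (u powr (d / t) * r powr (DIM('a) * d / t)) = L * u powr (d / t)"
        proof -
          have "DIM('a) * d / t = DIM('a) / t - \<alpha>"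
            using dn t by (simp add: t_def[symmetric] mult.commute diff_divide_distrib)
          then have "DIM('a) * (1 - 1 / t) + DIM('a) * d / t = DIM('a) - \<alpha>"
            by (simp add: algebra_simps)
          then have "r powr (DIM('a) * (1 - 1 / t)) * r powr (DIM('a) * d / t) = r powr (DIM('a) - \<alpha>)"
            by (simp only: powr_add[symmetric])
          then show ?thesis using r by (simp add: field_simps)
        qed
        also have "ennreal (L * u powr (d / t)) * epow ?M (1 / t) \<le> ennreal C * epow ?M (1 / t)"
          by (intro mult_right_mono ennreal_leI) (auto simp: C_def)
        finally show "ennreal (1 / r powr (real DIM('a) - \<alpha>)) * (\<integral>\<^sup>+ y\<in>cball 0 r. (G y * \<Phi> (x - y)) \<partial>lborel) \<le>
          ennreal C * epow ?M (1 / t)" .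
      qed
    qed
  qed
qed

section \<open>Weighted Morrey spaces\<close>

lemma weight_imp_measurable:
  fixes w :: "'a::euclidean_space \<Rightarrow> real"
  assumes "weight w"
  shows "w \<in> borel_measurable lebesgue"
proof (rule borel_measurable_LIMSEQ_real)
  show "(\<lambda>n. indicator (cball 0 (real n)) x *\<^sub>R w x) \<longlonglongrightarrow> w x" for x
  proof (rule tendsto_eventually)
    obtain n0 where "norm x \<le> real n0" using real_arch_simple by blast
    then show "\<forall>\<^sub>F n in sequentially. indicator (cball 0 (real n)) x *\<^sub>R w x = w x"
      by (intro eventually_sequentiallyI[of n0]) auto
  qed
  show "(\<lambda>x. indicator (cball 0 (real n)) x *\<^sub>R w x) \<in> borel_measurable lebesgue" for n
    using assms compact_cball[of "0::'a" "real n"]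
    by (intro borel_measurable_integrable) (auto simp: weight_def set_integrable_def)
qed

text \<open>Since \<open>0 * \<infinity> = 0\<close>, the class \<^const>\<open>A_class\<close> contains the weights that vanish almost everywhere.\<close>

lemma AE_zero_or_AE_pos:
  fixes u :: "'a::euclidean_space \<Rightarrow> real"
  assumes [measurable]: "u \<in> borel_measurable lebesgue" and nonneg: "\<And>x. 0 \<le> u x"
    and P: "1 < P" and Q: "0 < Q"
    and A: "\<And>c r. 0 < r \<Longrightarrow>
     epow ((\<integral>\<^sup>+ x\<in>ball c r. epow (ennreal (u x)) Q \<partial>lebesgue) / emeasure lebesgue (ball c r)) (1 / Q)
     * epow ((\<integral>\<^sup>+ x\<in>ball c r. epow (ennreal (u x)) (- (P / (P - 1))) \<partial>lebesgue)
             / emeasure lebesgue (ball c r)) (1 / (P / (P - 1))) \<le> ennreal C"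
  shows "(AE x in lebesgue. u x = 0) \<or> (AE x in lebesgue. 0 < u x)"
proof (rule disjCI)
  assume not0: "\<not> (AE x in lebesgue. 0 < u x)"
  define a where "a r = (\<integral>\<^sup>+ x\<in>ball 0 r. epow (ennreal (u x)) Q \<partial>lebesgue)" for r
  define b where "b r = (\<integral>\<^sup>+ x\<in>ball 0 r. epow (ennreal (u x)) (- (P / (P - 1))) \<partial>lebesgue)" for r
  have conj: "0 < 1 / (P / (P - 1))" "- (P / (P - 1)) < 0" using P by auto
  \<comment> \<open>If \<open>u^Q\<close> has nonzero integral over the ball, the bound
    \<open>A\<close> forces the negative power to have finite integral there. As that power is
    infinite where \<open>u = 0\<close>, positivity almost everywhere on the ball follows.\<close>
  have *: "AE x in lebesgue. x \<in> ball 0 r \<longrightarrow> 0 < u x" if r: "0 < r" and "a r \<noteq> 0" for r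
  proof -
    have em: "emeasure lebesgue (ball (0::'a) r) < top" "emeasure lebesgue (ball (0::'a) r) \<noteq> 0"
      using r by (auto simp: emeasure_ball unit_ball_vol_pos less_imp_neq[symmetric])
    have "epow (a r / emeasure lebesgue (ball (0::'a) r)) (1 / Q) \<noteq> 0"
      using \<open>a r \<noteq> 0\<close> Q em by (simp add: epow_eq_0_iff)
    moreover have "epow (a r / emeasure lebesgue (ball (0::'a) r)) (1 / Q) *
        epow (b r / emeasure lebesgue (ball (0::'a) r)) (1 / (P / (P - 1))) \<noteq> top"
      using A[OF r, of 0] by (auto simp: a_def b_def top_unique)
    ultimately have "epow (b r / emeasure lebesgue (ball (0::'a) r)) (1 / (P / (P - 1))) \<noteq> top"
      by (metis ennreal_mult_top)
    then have "b r \<noteq> \<infinity>"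
      using conj em by (auto simp: epow_eq_top_iff ennreal_divide_eq_top_iff)
    then have "AE x in lebesgue. epow (ennreal (u x)) (- (P / (P - 1))) * indicator (ball 0 r) x \<noteq> \<infinity>"
      unfolding b_def by (intro nn_integral_PInf_AE) auto
    then show "AE x in lebesgue. x \<in> ball 0 r \<longrightarrow> 0 < u x"
    proof eventually_elim
      case (elim x)
      have "epow 0 (- (P / (P - 1))) = top"
        using divide_pos_pos[of P "P - 1"] P by (simp add: epow_def not_less)
      then show ?case using elim nonneg[of x] by (cases "u x = 0") auto
    qed
  qed
  have "\<not> (\<forall>n. AE x in lebesgue. x \<in> ball 0 (real (Suc n)) \<longrightarrow> 0 < u x)"
  proof
    assume "\<forall>n. AE x in lebesgue. x \<in> ball 0 (real (Suc n)) \<longrightarrow> 0 < u x"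
    then have "AE x in lebesgue. \<forall>n. x \<in> ball 0 (real (Suc n)) \<longrightarrow> 0 < u x"
      by (subst AE_all_countable)
    then have "AE x in lebesgue. 0 < u x"
    proof eventually_elim
      case (elim x)
      obtain n where "norm x < real n" using reals_Archimedean2 by blast
      then show ?case using elim[rule_format, of n] by simp
    qed
    then show False using not0 by simp
  qed
  then obtain N where N: "\<not> (AE x in lebesgue. x \<in> ball 0 (real (Suc N)) \<longrightarrow> 0 < u x)" by blast
  have "AE x in lebesgue. x \<in> ball 0 (real (Suc n)) \<longrightarrow> u x = 0" for n
  proof -
    \<comment> \<open>Failure of positivity on the ball of index \<open>N\<close> persists on every
      larger ball, so \<open>u^Q\<close> has integral 0 on balls that exhaust the space.\<close>
    let ?r = "real (Suc (max n N))"
    have "\<not> (AE x in lebesgue. x \<in> ball 0 ?r \<longrightarrow> 0 < u x)"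
    proof
      assume "AE x in lebesgue. x \<in> ball 0 ?r \<longrightarrow> 0 < u x"
      then have "AE x in lebesgue. x \<in> ball 0 (real (Suc N)) \<longrightarrow> 0 < u x"
        by eventually_elim auto
      then show False using N by simp
    qed
    then have "a ?r = 0" using *[of ?r] by fastforce
    then have "AE x in lebesgue. epow (ennreal (u x)) Q * indicator (ball 0 ?r) x = 0"
      unfolding a_def by (subst (asm) nn_integral_0_iff_AE) auto
    then show ?thesis
    proof eventually_elim
      case (elim x)
      then show ?case using nonneg[of x] Q by (auto simp: epow_eq_0_iff indicator_def split: if_splits)
    qed
  qed
  then have "AE x in lebesgue. \<forall>n. x \<in> ball 0 (real (Suc n)) \<longrightarrow> u x = 0"
    by (subst AE_all_countable) (rule allI)
  then show "AE x in lebesgue. u x = 0"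
  proof eventually_elim
    case (elim x)
    obtain n where "norm x < real n" using reals_Archimedean2 by blast
    then show ?case using elim[rule_format, of n] by simp
  qed
qed

text \<open>Both averages are nonzero, so a finite bound for their product makes each of them
  finite; this supplies the local integrability of \<open>W^Q\<close> and
  \<open>W^-P'\<close>.\<close>

lemma A_class_imp_apq_weight:
  fixes u :: "'a::euclidean_space \<Rightarrow> real"
  assumes u: "u \<in> A_class P Q" and P: "1 < P" "P < Q" and pos: "AE x in lebesgue. 0 < u x"
  obtains W A where "apq_weight W P Q A" "AE x in lebesgue. W x = u x"
proof -
  have [measurable]: "u \<in> borel_measurable lebesgue"
    using u by (auto simp: A_class_def intro: weight_imp_measurable)
  \<comment> \<open>Any positive value would do on the null set where \<open>u\<close>
    vanishes.\<close>
  define W where "W x = (if 0 < u x then u x else 1)" for x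
  have W_meas [measurable]: "W \<in> borel_measurable lebesgue" unfolding W_def[abs_def] by measurable
  have W_pos: "0 < W x" for x by (simp add: W_def)
  have W_eq: "AE x in lebesgue. W x = u x" using pos by eventually_elim (simp add: W_def)
  define P' where "P' = P / (P - 1)"
  have P': "0 < P'" "1 / P' = 1 - 1 / P" using P by (auto simp: P'_def field_simps)
  define a where "a c r = (\<integral>\<^sup>+ x\<in>ball c r. ennreal (W x powr Q) \<partial>lebesgue)" for c r
  define b where "b c r = (\<integral>\<^sup>+ x\<in>ball c r. ennreal (W x powr - P') \<partial>lebesgue)" for c r
  have eq: "(\<integral>\<^sup>+ x\<in>ball c r. epow (ennreal (u x)) e \<partial>lebesgue) = (\<integral>\<^sup>+ x\<in>ball c r. ennreal (W x powr e) \<partial>lebesgue)" for c r e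
    using W_eq W_pos by (intro nn_integral_cong_AE) (auto elim!: eventually_mono simp flip: epow_ennreal)
  obtain C where C: "0 < C" "\<And>c r. 0 < r \<Longrightarrow> epow (a c r / emeasure lebesgue (ball c r)) (1 / Q)
      * epow (b c r / emeasure lebesgue (ball c r)) (1 / P') \<le> ennreal C"
    using u unfolding A_class_def a_def b_def by (auto simp: eq conj_exp_ereal P'_def)
  have em: "emeasure lebesgue (ball (c::'a) r) < top" "emeasure lebesgue (ball c r) \<noteq> 0" if "0 < r" for c r
    using that by (auto simp: emeasure_ball unit_ball_vol_pos less_imp_neq[symmetric])
  have ab_pos: "a c r \<noteq> 0" "b c r \<noteq> 0" if "0 < r" for c r
    using set_nn_integral_powr_pos[OF W_meas W_pos that] by (auto simp: a_def b_def less_imp_neq[symmetric])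
  have fin: "a c r \<noteq> top" "b c r \<noteq> top" if r: "0 < r" for c r
  proof -
    have 1: "epow (a c r / emeasure lebesgue (ball c r)) (1 / Q) \<noteq> 0"
      "epow (b c r / emeasure lebesgue (ball c r)) (1 / P') \<noteq> 0"
      using ab_pos[OF r, of c] em[OF r, of c] P P' by (auto simp: epow_eq_0_iff)
    moreover have "epow (a c r / emeasure lebesgue (ball c r)) (1 / Q) * epow (b c r / emeasure lebesgue (ball c r)) (1 / P') \<noteq> top"
      using C(2)[OF r, of c] by (auto simp: top_unique)
    ultimately have "epow (a c r / emeasure lebesgue (ball c r)) (1 / Q) \<noteq> top"
      "epow (b c r / emeasure lebesgue (ball c r)) (1 / P') \<noteq> top"
      by (auto simp: ennreal_mult_eq_top_iff)
    then show "a c r \<noteq> top" "b c r \<noteq> top"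
      using em[OF r, of c] P P' by (auto simp: epow_eq_top_iff ennreal_divide_eq_top_iff)
  qed
  have "apq_weight W P Q C"
  proof
    show "1 < P" "P < Q" "0 < C" "0 < W x" for x using P C W_pos by auto
    fix c :: 'a and r :: real assume r: "0 < r"
    show "(\<integral>\<^sup>+ x\<in>ball c r. ennreal (W x powr Q) \<partial>lebesgue) < \<infinity>"
      "(\<integral>\<^sup>+ x\<in>ball c r. ennreal (W x powr - (P / (P - 1))) \<partial>lebesgue) < \<infinity>"
      using fin[OF r, of c] by (auto simp: a_def b_def P'_def less_top)
    let ?l = "emeasure lebesgue (ball c r)"
    have split: "z = z / ?l * ?l" for z :: ennreal
      using em[OF r, of c] by (simp add: ennreal_divide_times ennreal_times_divide mult_divide_eq_ennreal)
    have "epow (a c r) (1 / Q) * epow (b c r) (1 / P') =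
        epow (a c r / ?l) (1 / Q) * epow (b c r / ?l) (1 / P') * epow ?l (1 / Q + 1 / P')"
      using P P' by (subst split[of "a c r"], subst split[of "b c r"]) (simp add: epow_mult epow_add mult_ac)
    also have "\<dots> \<le> ennreal C * epow ?l (1 / Q + 1 / P')"
      by (intro mult_right_mono C r) auto
    finally show "epow (\<integral>\<^sup>+ x\<in>ball c r. ennreal (W x powr Q) \<partial>lebesgue) (1 / Q)
      * epow (\<integral>\<^sup>+ x\<in>ball c r. ennreal (W x powr - (P / (P - 1))) \<partial>lebesgue) (1 - 1 / P)
      \<le> ennreal C * epow (emeasure lebesgue (ball c r)) (1 / Q + 1 - 1 / P)"
      by (simp add: a_def b_def P'(2) P'_def[symmetric] add_diff_eq)
  qed (fact W_meas)
  with W_eq show ?thesis by (intro that)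
qed

section \<open>Morrey membership and norm bounds from inequalities on balls\<close>

lemma morrey_bound_imp:
  fixes h :: "'a::euclidean_space \<Rightarrow> ennreal"
  assumes [measurable]: "h \<in> borel_measurable lebesgue" and p: "0 < p" and B: "B < \<infinity>"
    and v: "\<And>c r. 0 < r \<Longrightarrow> (\<integral>\<^sup>+ x\<in>ball c r. ennreal (v x) \<partial>lebesgue) \<noteq> 0 \<and>
      (\<integral>\<^sup>+ x\<in>ball c r. ennreal (v x) \<partial>lebesgue) \<noteq> top"
    and \<kappa>: "0 < \<kappa>"
    and le: "\<And>c r. 0 < r \<Longrightarrow> (\<integral>\<^sup>+ x\<in>ball c r. epow (h x) p * ennreal (u x) \<partial>lebesgue) \<le>
      epow B p * epow (\<integral>\<^sup>+ x\<in>ball c r. ennreal (v x) \<partial>lebesgue) \<kappa>"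
  shows "h \<in> morrey p \<kappa> u v" "morrey_norm p \<kappa> u v h \<le> B"
proof -
  show norm: "morrey_norm p \<kappa> u v h \<le> B"
    unfolding morrey_norm_def
  proof (safe intro!: SUP_least)
    fix c :: 'a and r :: real assume r: "0 < r"
    let ?I = "\<integral>\<^sup>+ x\<in>ball c r. epow (h x) p * ennreal (u x) \<partial>lebesgue"
    let ?y = "epow (\<integral>\<^sup>+ x\<in>ball c r. ennreal (v x) \<partial>lebesgue) \<kappa>"
    have y: "?y \<noteq> 0" "?y \<noteq> top"
      using v[OF r, of c] \<kappa> by (auto simp: epow_eq_0_iff epow_eq_top_iff)
    have "?I / ?y \<le> epow B p * ?y / ?y" by (intro divide_right_mono_ennreal le r)
    also have "\<dots> = epow B p" using y by (simp add: mult_divide_eq_ennreal)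
    finally have "epow (?I / ?y) (1 / p) \<le> epow (epow B p) (1 / p)" using p by (intro epow_mono) auto
    also have "\<dots> = B" using p by (simp add: epow_epow)
    finally show "epow (?I / ?y) (1 / p) \<le> B" .
  qed
  have "(\<integral>\<^sup>+ x\<in>K. epow (h x) p * ennreal (u x) \<partial>lebesgue) < \<infinity>" if K: "compact K" for K
  proof -
    obtain R where R: "0 < R" "K \<subseteq> ball 0 R"
      using bounded_subset_ballD[OF compact_imp_bounded[OF K]] by blast
    have "(\<integral>\<^sup>+ x\<in>K. epow (h x) p * ennreal (u x) \<partial>lebesgue) \<le>
        (\<integral>\<^sup>+ x\<in>ball 0 R. epow (h x) p * ennreal (u x) \<partial>lebesgue)"
      using R by (intro nn_integral_mono) (auto simp: indicator_def)
    also have "\<dots> \<le> epow B p * epow (\<integral>\<^sup>+ x\<in>ball 0 R. ennreal (v x) \<partial>lebesgue) \<kappa>"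
      by (rule le[OF R(1)])
    also have "\<dots> < \<infinity>"
      using v[OF R(1), of 0] B p \<kappa> by (auto simp: less_top[symmetric] ennreal_mult_eq_top_iff epow_eq_top_iff)
    finally show ?thesis .
  qed
  then show "h \<in> morrey p \<kappa> u v"
    using norm B by (auto simp: morrey_def Lp_loc_def intro: le_less_trans)
qed

text \<open>All numerators in the norm are 0, and \<open>0 / y = 0\<close> holds even for
  \<open>y = 0\<close>. This settles the case of a weight that is 0 almost everywhere.\<close>

lemma morrey_AE_zero:
  fixes h :: "'a::euclidean_space \<Rightarrow> ennreal"
  assumes h: "h \<in> borel_measurable lebesgue" and p: "0 < p" and u: "AE x in lebesgue. u x = 0"
  shows "h \<in> morrey p \<kappa> u v" "morrey_norm p \<kappa> u v h = 0"
proof -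
  have I: "(\<integral>\<^sup>+ x\<in>K. epow (h x) p * ennreal (u x) \<partial>lebesgue) = 0" for K
  proof -
    have "(\<integral>\<^sup>+ x\<in>K. epow (h x) p * ennreal (u x) \<partial>lebesgue) = (\<integral>\<^sup>+ (x::'a). 0 \<partial>lebesgue)"
      using u by (intro nn_integral_cong_AE) (auto elim!: eventually_mono)
    then show ?thesis by simp
  qed
  then show norm: "morrey_norm p \<kappa> u v h = 0"
  proof -
    have "morrey_norm p \<kappa> u v h \<le> 0"
      unfolding morrey_norm_def I using p by (safe intro!: SUP_least) simp
    then show ?thesis by simp
  qed
  then show "h \<in> morrey p \<kappa> u v"
    using h I by (auto simp: morrey_def Lp_loc_def)
qed

section \<open>Application to the weight \<open>w^t\<close> and the function
  \<open>|f|^t\<close>\<close>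

theorem theorem1p1:
  fixes \<Omega> :: "real ^ 'n \<Rightarrow> complex"
    and w :: "real ^ 'n \<Rightarrow> real"
    and s :: ereal
    and \<alpha> p q \<kappa> :: real
  assumes "CARD('n) \<ge> 2"
    and "1 < s"
    and "\<Omega> \<in> Ls_sphere s" and "homogeneous_deg0 \<Omega>"
    and "0 < \<alpha>" and "\<alpha> < real CARD('n)"
    and "1 \<le> conj_exp s" and "conj_exp s < p" and "p < real CARD('n) / \<alpha>"
    and "1 / q = 1 / p - \<alpha> / real CARD('n)"
    and "0 < \<kappa>" and "\<kappa> < p / q"
    and "weight w"
    and "(\<lambda>x. w x powr conj_exp s) \<in> A_class (p / conj_exp s) (q / conj_exp s)"
  shows "\<exists>C::real. C > 0 \<and>
    (\<forall>f :: real ^ 'n \<Rightarrow> complex.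
       f \<in> borel_measurable lebesgue \<longrightarrow>
       modulus f \<in> morrey p \<kappa> (\<lambda>x. w x powr p) (\<lambda>x. w x powr q) \<longrightarrow>
       frac_max \<Omega> \<alpha> f \<in> morrey q (\<kappa> * q / p) (\<lambda>x. w x powr q) (\<lambda>x. w x powr q) \<and>
       morrey_norm q (\<kappa> * q / p) (\<lambda>x. w x powr q) (\<lambda>x. w x powr q) (frac_max \<Omega> \<alpha> f)
         \<le> ennreal C * morrey_norm p \<kappa> (\<lambda>x. w x powr p) (\<lambda>x. w x powr q) (modulus f))"
proof -
  define t where "t = conj_exp s"
  define n where "n = real CARD('n)"
  define P where "P = p / t"
  define Q where "Q = q / t"
  define u where "u = (\<lambda>x. w x powr t)"
  have t: "1 \<le> t" "t < p" using assms by (auto simp: t_def)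
  have n: "0 < n" "real DIM(real ^ 'n) = n" by (auto simp: n_def)
  \<comment> \<open>Makes \<open>1 / q\<close> positive; together with \<open>\<alpha> > 0\<close>
    this yields \<open>0 < p < q\<close>.\<close>
  have "\<alpha> / n < 1 / p"
    using \<open>p < real CARD('n) / \<alpha>\<close> \<open>0 < \<alpha>\<close> t n by (simp add: n_def field_simps)
  then have inv_q: "0 < 1 / q" "1 / q < 1 / p"
    using assms(10) \<open>0 < \<alpha>\<close> n by (simp_all add: n_def)
  then have q: "0 < q" by simp
  have pq: "p < q" using inv_q q t by (simp add: field_simps)
  have PQ: "1 < P" "P < Q" using t pq by (auto simp: P_def Q_def divide_strict_right_mono)
  have eqs: "P * t = p" "Q * t = q" "t * P = p" "t * Q = q" "\<kappa> * Q / P = \<kappa> * q / p" "P / Q = p / q"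
    using t by (auto simp: P_def Q_def)
  have u: "u \<in> A_class P Q" using assms(14) by (simp add: u_def P_def Q_def t_def)
  have [measurable]: "u \<in> borel_measurable lebesgue"
    using u by (auto simp: A_class_def intro: weight_imp_measurable)
  \<comment> \<open>The exponent \<open>d\<close> of the locale, introduced in advance because the
    comparison with \<open>frac_maximal_fun\<close> comes before a positive weight is
    available.\<close>
  define e where "e = 1 / Q + 1 / (P / (P - 1))"
  have e: "e * real DIM(real ^ 'n) = real DIM(real ^ 'n) - \<alpha> * conj_exp s"
  proof -
    have "1 / Q = t * (1 / q)" "1 / (P / (P - 1)) = 1 - t * (1 / p)"
      using PQ t by (auto simp: P_def Q_def field_simps)
    then have "e = 1 - t * (1 / p - 1 / q)" by (simp add: e_def algebra_simps)
    also have "1 / p - 1 / q = \<alpha> / n" using assms(10) by (simp add: n_def)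
    finally have "e * n = n - \<alpha> * t" using n(1) by (simp add: field_simps)
    then show ?thesis unfolding n(2) t_def .
  qed
  obtain C1 :: real where C1: "0 < C1"
    "\<And>f. f \<in> borel_measurable lebesgue \<Longrightarrow> frac_max \<Omega> \<alpha> f \<in> borel_measurable lebesgue"
    "\<And>f x. f \<in> borel_measurable lebesgue \<Longrightarrow> frac_max \<Omega> \<alpha> f x \<le>
      ennreal C1 * epow (frac_maximal_fun e (\<lambda>y. epow (modulus f y) t) x) (1 / t)"
    using frac_max_le_frac_maximal_fun[OF \<open>\<Omega> \<in> Ls_sphere s\<close> \<open>1 < s\<close> \<open>1 \<le> conj_exp s\<close> e]
    unfolding t_def by metis
  from u obtain C where C: "\<And>c r. 0 < r \<Longrightarrow>
     epow ((\<integral>\<^sup>+ x\<in>ball c r. epow (ennreal (u x)) Q \<partial>lebesgue) / emeasure lebesgue (ball c r)) (1 / Q)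
     * epow ((\<integral>\<^sup>+ x\<in>ball c r. epow (ennreal (u x)) (- (P / (P - 1))) \<partial>lebesgue)
             / emeasure lebesgue (ball c r)) (1 / (P / (P - 1))) \<le> ennreal C"
    unfolding A_class_def conj_exp_ereal by blast
  have "(AE x in lebesgue. u x = 0) \<or> (AE x in lebesgue. 0 < u x)"
  proof (rule AE_zero_or_AE_pos[OF _ _ PQ(1) _ C])
    show "0 \<le> u x" for x by (simp add: u_def)
    show "0 < Q" using PQ by simp
  qed simp
  then show ?thesis
  proof
    \<comment> \<open>The norm on the left of the claim is 0, so any positive constant
      works.\<close>
    assume "AE x in lebesgue. u x = 0"
    then have "AE x in lebesgue. w x powr q = 0" by eventually_elim (simp add: u_def)
    then show ?thesis
      using morrey_AE_zero[OF C1(2) q] by (intro exI[of _ 1]) auto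
  next
    assume "AE x in lebesgue. 0 < u x"
    then obtain W A where "apq_weight W P Q A" and W: "AE x in lebesgue. W x = u x"
      using A_class_imp_apq_weight[OF u PQ] by blast
    then interpret apq_weight W P Q A by simp
    have d_eq: "d = e" by (simp add: d_def e_def P'_def)
    have \<kappa>: "\<kappa> < P / Q" using assms(12) by (simp add: eqs)
    obtain C2 where C2: "0 < C2"
      "\<forall>F\<in>borel_measurable lebesgue. \<forall>N.
      (\<forall>c r. 0 < r \<longrightarrow> (\<integral>\<^sup>+ x\<in>ball c r. epow (F x) P * ennreal (W x powr P) \<partial>lebesgue)
        \<le> epow N P * epow (emeasure V (ball c r)) \<kappa>) \<longrightarrow>
      (\<forall>c r. 0 < r \<longrightarrow>
        (\<integral>\<^sup>+ x\<in>ball c r. epow (frac_maximal_fun e F x) Q * ennreal (W x powr Q) \<partial>lebesgue)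
        \<le> ennreal C2 * epow N Q * epow (emeasure V (ball c r)) (\<kappa> * Q / P))"
      using frac_maximal_fun_morrey[OF assms(11) \<kappa>] unfolding d_eq by (elim exE conjE)
    have Wp: "AE x in lebesgue. W x powr P = w x powr p" and Wq: "AE x in lebesgue. W x powr Q = w x powr q"
      using W by (eventually_elim, simp add: u_def powr_powr eqs)+
    have V_eq: "(\<integral>\<^sup>+ x\<in>ball c r. ennreal (w x powr q) \<partial>lebesgue) = emeasure V (ball c r)" for c r
      unfolding emeasure_V[OF sets_lebesgue_ball(1)]
      using Wq by (intro nn_integral_cong_AE) (auto elim!: eventually_mono)
    have V: "emeasure V (ball c r) \<noteq> 0" "emeasure V (ball c r) \<noteq> top" if "0 < r" for c r
      using emeasure_V_ball[OF that, of c] by auto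
    \<comment> \<open>The inequality between \<open>q\<close>-th powers will hold with the constant
      \<open>C1^q * C2\<close>, of which this is the \<open>q\<close>-th root.\<close>
    define C where "C = C1 * C2 powr (1 / q)"
    have "0 < C" using C1(1) C2(1) by (simp add: C_def)
    have "frac_max \<Omega> \<alpha> f \<in> morrey q (\<kappa> * q / p) (\<lambda>x. w x powr q) (\<lambda>x. w x powr q) \<and>
       morrey_norm q (\<kappa> * q / p) (\<lambda>x. w x powr q) (\<lambda>x. w x powr q) (frac_max \<Omega> \<alpha> f)
         \<le> ennreal C * morrey_norm p \<kappa> (\<lambda>x. w x powr p) (\<lambda>x. w x powr q) (modulus f)"
      if f: "f \<in> borel_measurable lebesgue"
        and mf: "modulus f \<in> morrey p \<kappa> (\<lambda>x. w x powr p) (\<lambda>x. w x powr q)" for f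
    proof -
      define N where "N = morrey_norm p \<kappa> (\<lambda>x. w x powr p) (\<lambda>x. w x powr q) (modulus f)"
      have N: "N < \<infinity>" using mf by (simp add: morrey_def N_def)
      define F where "F = (\<lambda>y. epow (modulus f y) t)"
      have modulus_meas: "modulus f \<in> borel_measurable lebesgue"
        using f unfolding modulus_def by simp
      then have F_meas [measurable]: "F \<in> borel_measurable lebesgue" unfolding F_def by simp
      \<comment> \<open>The hypothesis of \<open>frac_maximal_fun_morrey\<close> for
        \<open>F\<close>, with the constant \<open>epow N t\<close> in the role of \<open>N\<close>:
        its \<open>P\<close>-th power is \<open>epow N p\<close>, since
        \<open>t * P = p\<close>.\<close>
      have F_le: "(\<integral>\<^sup>+ x\<in>ball c r. epow (F x) P * ennreal (W x powr P) \<partial>lebesgue)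
          \<le> epow (epow N t) P * epow (emeasure V (ball c r)) \<kappa>" if r: "0 < r" for c r
      proof -
        have "(\<integral>\<^sup>+ x\<in>ball c r. epow (F x) P * ennreal (W x powr P) \<partial>lebesgue) =
            (\<integral>\<^sup>+ x\<in>ball c r. epow (modulus f x) p * ennreal (w x powr p) \<partial>lebesgue)"
          using Wp by (intro nn_integral_cong_AE) (auto elim!: eventually_mono simp: F_def epow_epow eqs)
        also have "\<dots> \<le> epow N p * epow (emeasure V (ball c r)) \<kappa>"
        proof (rule epow_le_divD)
          show "epow ((\<integral>\<^sup>+ x\<in>ball c r. epow (modulus f x) p * ennreal (w x powr p) \<partial>lebesgue) /
              epow (emeasure V (ball c r)) \<kappa>) (1 / p) \<le> N"
            unfolding N_def morrey_norm_def V_eq[symmetric] using r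
            by (intro SUP_upper2[where i="(c, r)"]) auto
        qed (use t V[OF r] assms(11) in \<open>auto simp: epow_eq_0_iff epow_eq_top_iff\<close>)
        finally show ?thesis by (simp add: epow_epow eqs)
      qed
      have CN: "ennreal C * N < \<infinity>" using N by (simp add: ennreal_mult_less_top)
      have le: "(\<integral>\<^sup>+ x\<in>ball c r. epow (frac_max \<Omega> \<alpha> f x) q * ennreal (w x powr q) \<partial>lebesgue) \<le>
          epow (ennreal C * N) q * epow (\<integral>\<^sup>+ x\<in>ball c r. ennreal (w x powr q) \<partial>lebesgue) (\<kappa> * q / p)"
        if r: "0 < r" for c r
      proof -
        have le_pt: "epow (frac_max \<Omega> \<alpha> f x) q \<le> ennreal (C1 powr q) * epow (frac_maximal_fun e F x) Q" for x
        proof -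
          have "epow (frac_max \<Omega> \<alpha> f x) q \<le> epow (ennreal C1 * epow (frac_maximal_fun e F x) (1 / t)) q"
            unfolding F_def using C1(3)[OF f] q by (intro epow_mono) auto
          also have "\<dots> = ennreal (C1 powr q) * epow (frac_maximal_fun e F x) Q"
            using q C1(1) by (simp add: epow_mult epow_epow epow_ennreal Q_def)
          finally show ?thesis .
        qed
        have "(\<integral>\<^sup>+ x\<in>ball c r. epow (frac_max \<Omega> \<alpha> f x) q * ennreal (w x powr q) \<partial>lebesgue) \<le>
            (\<integral>\<^sup>+ x. ennreal (C1 powr q) * (epow (frac_maximal_fun e F x) Q * ennreal (W x powr Q) * indicator (ball c r) x) \<partial>lebesgue)"
          using Wq by (intro nn_integral_mono_AE)
            (auto elim!: eventually_mono simp: mult.assoc[symmetric] intro!: mult_right_mono le_pt)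
        also have "\<dots> = ennreal (C1 powr q) *
            (\<integral>\<^sup>+ x\<in>ball c r. epow (frac_maximal_fun e F x) Q * ennreal (W x powr Q) \<partial>lebesgue)"
          by (intro nn_integral_cmult) measurable
        also have "\<dots> \<le> ennreal (C1 powr q) * (ennreal C2 * epow (epow N t) Q * epow (emeasure V (ball c r)) (\<kappa> * Q / P))"
          by (intro mult_left_mono C2(2)[rule_format] F_le F_meas r) auto
        also have "\<dots> = epow (ennreal C * N) q * epow (emeasure V (ball c r)) (\<kappa> * q / p)"
          using q C1(1) C2(1) \<open>0 < C\<close>
          by (simp add: epow_epow eqs epow_mult epow_ennreal) (simp add: C_def powr_mult powr_powr ennreal_mult mult_ac)
        finally show ?thesis by (simp add: V_eq)
      qed
      have k: "0 < \<kappa> * q / p" using assms(11) q t by simp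
      show ?thesis
        unfolding N_def[symmetric] using V
        by (intro conjI morrey_bound_imp[OF C1(2)[OF f] q CN _ k le]) (auto simp: V_eq)
    qed
    then show ?thesis using \<open>0 < C\<close> by blast
  qed
qed

end
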